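(* Every pseudo double wheel 1-planar graph (even or odd) is bar 1-visible.
   Context: Let $n\ge 3$ and let $C$ be a cycle $v_1u_1v_2u_2\cdots v_nu_n$ embedded in the plane, let $x$ be a vertex outside $C$ and $y$ a vertex inside $C$; join $x$ to every $u_i$ and $y$ to every $v_i$ ($1\le i\le n$). The resulting plane graph $H$ has only quadrilateral faces; in each face of $H$ add the two diagonals as a pair of crossing edges. The resulting graph (which is an optimal 1-planar graph) is called an even pseudo double wheel 1-planar graph. A $Q_v$ splitting at a vertex $v_1$ is the following operation: choose vertices $v_2,v_3$ such that $v_1v_2$ and $v_1v_3$ are edges but $v_2v_3$ is not; split the path $v_2v_1v_3$, i.e. duplicate $v_1$ into two copies, each adjacent to $v_2$ and $v_3$, the edges at $v_1$ lying on one side of the path staying at one copy and those on the other side going to the other copy; rename one copy as $v_4$; and add the edges $v_1v_4$ and $v_2v_3$. An odd pseudo double wheel 1-planar graph is an optimal 1-planar graph obtained from an even pseudo double wheel 1-planar graph by one $Q_v$ splitting. A pseudo double wheel 1-planar graph is an even or odd one. A 1-planar graph is one that can be drawn in the plane with each edge crossed at most once; it is optimal if it has the maximum possible number $4n-8$ of edges for its number $n$ of vertices. A bar 1-visibility drawing of a graph $G$ draws each vertex as a horizontal line segment (a bar), pairwise disjoint, and each edge $(u,v)$ as a vertical line segment whose two endpoints lie on the bars of $u$ and $v$, such that the vertical segment of each edge intersects at most one bar other than the bars of its two end vertices; $G$ is bar 1-visible if it has such a drawing. *)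

theory Defs
  imports "HOL-Analysis.Analysis"
begin

section \<open>Simple graphs and rotation systems\<close>

definition simple_graph :: "'a set \<Rightarrow> 'a set set \<Rightarrow> bool" where
  "simple_graph V E \<longleftrightarrow> finite V \<and> (\<forall>e\<in>E. e \<subseteq> V \<and> card e = 2)"

text \<open>A drawing is recorded by its rotation system: \<open>R v\<close> lists the neighbours of \<open>v\<close> in the
  anticlockwise order in which the edges leave \<open>v\<close>; only the cyclic order matters.\<close>

type_synonym 'a rotation = "'a \<Rightarrow> 'a list"

definition rotation_edges :: "'a set \<Rightarrow> 'a rotation \<Rightarrow> 'a set set" where
  "rotation_edges V R = {{v, w} | v w. v \<in> V \<and> w \<in> set (R v)}"

definition cyclic_pred :: "'a list \<Rightarrow> 'a \<Rightarrow> 'a" where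
  "cyclic_pred ws a = last (dropWhile (\<lambda>b. b \<noteq> a) ws @ takeWhile (\<lambda>b. b \<noteq> a) ws)"

text \<open>If \<open>a\<close> and \<open>b\<close> are consecutive in \<open>R v\<close>, then the face in the corner at \<open>v\<close> between
  \<open>va\<close> and \<open>vb\<close> has the boundary walk \<open>b, v, a, c, \<dots>\<close> with \<open>c = cyclic_pred (R a) v\<close>. When
  all faces are quadrilaterals \<open>b v a c\<close>, the two diagonals of this face are \<open>vc\<close> and \<open>ab\<close>, and
  \<open>vc\<close> leaves \<open>v\<close> between \<open>va\<close> and \<open>vb\<close>.\<close>

definition add_face_diagonals :: "'a rotation \<Rightarrow> 'a rotation" where
  "add_face_diagonals R = (\<lambda>v. concat (map (\<lambda>a. [a, cyclic_pred (R a) v]) (R v)))"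


section \<open>Pseudo double wheel 1-planar graphs\<close>

text \<open>The cycle \<open>v 0, u 0, v 1, u 1, \<dots>, v (n - 1), u (n - 1)\<close> is drawn anticlockwise, with \<open>x\<close>
  outside and \<open>y\<close> inside. Seen from \<open>x\<close>, the \<open>u i\<close> therefore appear in decreasing order.\<close>

definition pdw_quadrangulation ::
  "nat \<Rightarrow> (nat \<Rightarrow> 'a) \<Rightarrow> (nat \<Rightarrow> 'a) \<Rightarrow> 'a \<Rightarrow> 'a \<Rightarrow> 'a set \<Rightarrow> 'a rotation \<Rightarrow> bool" where
  "pdw_quadrangulation n v u x y V R \<longleftrightarrow>
     n \<ge> 3 \<and>
     distinct (x # y # map v [0..<n] @ map u [0..<n]) \<and>
     V = {x, y} \<union> v ` {..<n} \<union> u ` {..<n} \<and>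
     R x = rev (map u [0..<n]) \<and>
     R y = map v [0..<n] \<and>
     (\<forall>i<n. R (v i) = [y, u ((i + n - 1) mod n), u i]) \<and>
     (\<forall>i<n. R (u i) = [x, v ((i + 1) mod n), v i])"

definition even_pdw_drawing :: "'a set \<Rightarrow> 'a rotation \<Rightarrow> bool" where
  "even_pdw_drawing V R \<longleftrightarrow>
     (\<exists>n v u x y S. pdw_quadrangulation n v u x y V S \<and> R = add_face_diagonals S)"

definition even_pdw_graph :: "'a set \<Rightarrow> 'a set set \<Rightarrow> bool" where
  "even_pdw_graph V E \<longleftrightarrow> (\<exists>R. even_pdw_drawing V R \<and> E = rotation_edges V R)"

text \<open>The edges leaving \<open>v1\<close> are, in cyclic order, the one to \<open>v2\<close>, those to \<open>ws\<close> on one side of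
  the path \<open>v2 v1 v3\<close>, the one to \<open>v3\<close>, and those to \<open>ws'\<close> on the other side. One copy of \<open>v1\<close>
  keeps the name \<open>v1\<close> and the edges to \<open>ws\<close>; the other one is the new vertex \<open>v4\<close>.\<close>

definition Qv_splitting ::
  "'a set \<Rightarrow> 'a rotation \<Rightarrow> 'a \<Rightarrow> 'a \<Rightarrow> 'a \<Rightarrow> 'a \<Rightarrow> 'a set \<Rightarrow> 'a set set \<Rightarrow> bool" where
  "Qv_splitting V R v1 v2 v3 v4 V' E' \<longleftrightarrow>
     v1 \<in> V \<and> v2 \<in> V \<and> v3 \<in> V \<and> v2 \<noteq> v3 \<and> v4 \<notin> V \<and>
     {v2, v3} \<notin> rotation_edges V R \<and>
     (\<exists>k ws ws'. rotate k (R v1) = v2 # ws @ v3 # ws' \<and>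
        V' = insert v4 V \<and>
        E' = (rotation_edges V R - {{v1, w} | w. w \<in> set ws'})
             \<union> {{v4, w} | w. w \<in> set ws'}
             \<union> {{v4, v2}, {v4, v3}}
             \<union> {{v1, v4}, {v2, v3}})"


section \<open>Optimal 1-planar graphs\<close>

text \<open>A common interior point of two edges counts as a crossing of either edge with the other one,
  and \<open>edge_crossings V E pos c e\<close> contains at most one element iff \<open>e\<close> is crossed at most once.\<close>

definition edge_crossings ::
  "'a set \<Rightarrow> 'a set set \<Rightarrow> ('a \<Rightarrow> complex) \<Rightarrow> ('a set \<Rightarrow> real \<Rightarrow> complex) \<Rightarrow> 'a set
     \<Rightarrow> ('a set \<times> complex) set" where
  "edge_crossings V E pos c e =
     {(f, p). f \<in> E \<and> f \<noteq> e \<and> p \<in> path_image (c e) \<inter> path_image (c f) - pos ` V}"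

definition one_planar_drawing ::
  "'a set \<Rightarrow> 'a set set \<Rightarrow> ('a \<Rightarrow> complex) \<Rightarrow> ('a set \<Rightarrow> real \<Rightarrow> complex) \<Rightarrow> bool" where
  "one_planar_drawing V E pos c \<longleftrightarrow>
     inj_on pos V \<and>
     (\<forall>e\<in>E. arc (c e) \<and>
        {pathstart (c e), pathfinish (c e)} = pos ` e \<and>
        path_image (c e) \<inter> pos ` V = pos ` e \<and>
        finite (edge_crossings V E pos c e) \<and> card (edge_crossings V E pos c e) \<le> 1)"

definition one_planar :: "'a set \<Rightarrow> 'a set set \<Rightarrow> bool" where
  "one_planar V E \<longleftrightarrow> simple_graph V E \<and> (\<exists>pos c. one_planar_drawing V E pos c)"

definition optimal_one_planar :: "'a set \<Rightarrow> 'a set set \<Rightarrow> bool" where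
  "optimal_one_planar V E \<longleftrightarrow> one_planar V E \<and> int (card E) = 4 * int (card V) - 8"

definition odd_pdw_graph :: "'a set \<Rightarrow> 'a set set \<Rightarrow> bool" where
  "odd_pdw_graph V E \<longleftrightarrow>
     optimal_one_planar V E \<and>
     (\<exists>W R v1 v2 v3 v4. even_pdw_drawing W R \<and> Qv_splitting W R v1 v2 v3 v4 V E)"

definition pdw_graph :: "'a set \<Rightarrow> 'a set set \<Rightarrow> bool" where
  "pdw_graph V E \<longleftrightarrow> even_pdw_graph V E \<or> odd_pdw_graph V E"


section \<open>Bar 1-visibility\<close>

definition is_bar :: "(real \<times> real) set \<Rightarrow> bool" where
  "is_bar S \<longleftrightarrow> (\<exists>a b h. a < b \<and> S = closed_segment (a, h) (b, h))"

text \<open>The set in the last conjunct is finite for a finite vertex set, so that its \<open>card\<close> is not the default 0.\<close>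

definition bar_1_visibility_drawing ::
  "'a set \<Rightarrow> 'a set set \<Rightarrow> ('a \<Rightarrow> (real \<times> real) set) \<Rightarrow> ('a set \<Rightarrow> (real \<times> real) set) \<Rightarrow> bool"
  where
  "bar_1_visibility_drawing V E bar seg \<longleftrightarrow>
     (\<forall>w\<in>V. is_bar (bar w)) \<and>
     (\<forall>w\<in>V. \<forall>w'\<in>V. w \<noteq> w' \<longrightarrow> bar w \<inter> bar w' = {}) \<and>
     (\<forall>u v. {u, v} \<in> E \<longrightarrow>
        (\<exists>t p q. seg {u, v} = closed_segment (t, p) (t, q) \<and> (t, p) \<in> bar u \<and> (t, q) \<in> bar v) \<and>
        card {w \<in> V - {u, v}. seg {u, v} \<inter> bar w \<noteq> {}} \<le> 1)"

definition bar_1_visible :: "'a set \<Rightarrow> 'a set set \<Rightarrow> bool" where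
  "bar_1_visible V E \<longleftrightarrow> simple_graph V E \<and> (\<exists>bar seg. bar_1_visibility_drawing V E bar seg)"

end

(* With x and y deleted, the even graph is the square of a cycle, and deleting two further
   consecutive rim vertices leaves the square of a path. The path becomes a descending staircase of
   bars, at most three of which overlap at any abscissa; each of them is the topmost one somewhere and
   the lowest one somewhere. Two full-width bars above it and two below it, for x, y and the two
   deleted rim vertices, therefore each see the whole staircase past at most one other bar. Moreover
   the lower of the two places above the staircase can be shared by two vertices, one seeing the left
   and one the right part of the path. That suffices for every Q_v splitting: splitting x or y divides
   its neighbours into two arcs of the rim, and splitting a rim vertex only disturbs the left end of
   the path. *)

theory Submission
  imports Defs
begin

section \<open>A universal layout of bars\<close>

text \<open>A line of sight may pass only one foreign bar, which leaves room for two wide bars above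
  the staircase and two below it. Splitting a hub creates three vertices of possibly large degree
  (both halves and the other hub) besides the two deleted rim vertices. The halves can share a place
  because their neighbourhoods are arcs of the rim: after a rotation one separator is a deleted rim
  vertex, so at most one step, the other separator, has to be seen by both halves. The deleted
  vertices are consecutive because the rim also has edges of length two, which would jump across a
  single gap. Steps start 4 apart and have length 10. Since 8 < 10 < 12, steps \<open>i\<close>,
  \<open>i + 1\<close>, \<open>i + 2\<close> meet and \<open>i\<close>, \<open>i + 3\<close> do not:
  the adjacency of the square of a path. Step \<open>i\<close> is topmost at
  \<open>4 * i + 7\<close> and at \<open>4 * i + 9\<close>, and lowest at \<open>4 * i + 1\<close>.
  Omitting edges preserves visibility, so upper bounds for the edge sets of the split graphs
  suffice.\<close>

text \<open>\<open>SA\<close>, \<open>SB\<close>, \<open>SX\<close> are full-width bars, \<open>SP i\<close> is the \<open>i\<close>-th step of the staircase, and \<open>SZ\<close>, \<open>SY\<close>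
  lie above its left and right part; the parameter \<open>b\<close> is the step above which they overlap.\<close>

datatype slot = SA | SB | SX | SY | SZ | SP nat

fun level :: "nat \<Rightarrow> slot \<Rightarrow> int" where
  "level k SA = 3"
| "level k SZ = 2"
| "level k SY = 1"
| "level k (SP i) = - int i"
| "level k SB = - int k"
| "level k SX = - int k - 1"

text \<open>The staircase starts at 0, so \<open>-9\<close> meets only the three full-width bars and
  \<open>-1\<close> meets \<open>SZ\<close> in addition. \<open>SZ\<close> ends exactly where
  \<open>SY\<close> begins: the common abscissa \<open>4 * int b + 8\<close> carries the edge
  between the two halves of a hub.\<close>

fun left_end :: "nat \<Rightarrow> slot \<Rightarrow> int" where
  "left_end b SZ = -5"
| "left_end b SY = 4 * int b + 8"
| "left_end b (SP i) = 4 * int i"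
| "left_end b s = -10"

fun right_end :: "nat \<Rightarrow> nat \<Rightarrow> slot \<Rightarrow> int" where
  "right_end b k SZ = 4 * int b + 8"
| "right_end b k (SP i) = 4 * int i + 10"
| "right_end b k s = 4 * int k + 4 * int b + 20"

definition spans :: "nat \<Rightarrow> nat \<Rightarrow> int \<Rightarrow> slot \<Rightarrow> bool" where
  "spans b k t s \<longleftrightarrow> left_end b s \<le> t \<and> t \<le> right_end b k s"

definition slots :: "nat \<Rightarrow> slot set" where
  "slots k = {SA, SB, SX, SY, SZ} \<union> SP ` {..<k}"

text \<open>The bars in the way range over all slots, including those that a particular graph leaves
  empty, so one list of visibilities serves every assignment. When no bar is passed,
  \<open>c\<close> is an arbitrary name.\<close>

definition sees :: "nat \<Rightarrow> nat \<Rightarrow> slot \<Rightarrow> slot \<Rightarrow> bool" where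
  "sees b k s s' \<longleftrightarrow> (\<exists>t c. spans b k t s \<and> spans b k t s' \<and>
     (\<forall>w\<in>slots k. spans b k t w \<longrightarrow> w \<noteq> s \<longrightarrow> w \<noteq> s' \<longrightarrow>
        min (level k s) (level k s') \<le> level k w \<longrightarrow>
        level k w \<le> max (level k s) (level k s') \<longrightarrow> w = c))"

lemma sees_sym: "sees b k s s' \<Longrightarrow> sees b k s' s"
  unfolding sees_def by (metis max.commute min.commute)

lemma seesI:
  assumes "spans b k t s" "spans b k t s'" "level k s' \<le> level k s"
    and "\<And>w. w \<in> slots k \<Longrightarrow> spans b k t w \<Longrightarrow> w \<noteq> s \<Longrightarrow> w \<noteq> s' \<Longrightarrow>
      level k s' \<le> level k w \<Longrightarrow> level k w \<le> level k s \<Longrightarrow> w = c"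
  shows "sees b k s s'"
  unfolding sees_def using assms by (intro exI[of _ t] exI[of _ c]) (auto simp: min_def max_def)

lemma level_inj: "inj_on (level k) (slots k)"
  by (auto simp: inj_on_def slots_def)

lemma sees_full:
  "sees b k SA SB" "sees b k SA SX" "sees b k SA SZ" "sees b k SA SY"
  "sees b k SB SX" "sees b k SZ SB" "sees b k SY SB" "sees b k SZ SX" "sees b k SY SX" "sees b k SZ SY"
  subgoal by (rule seesI[where t="-9" and c=SA]) (auto simp: spans_def slots_def)
  subgoal by (rule seesI[where t="-9" and c=SB]) (auto simp: spans_def slots_def)
  subgoal by (rule seesI[where t="-1" and c=SA]) (auto simp: spans_def slots_def)
  \<comment> \<open>This abscissa lies to the right of the whole staircase and of \<open>SZ\<close>,
    so only \<open>SY\<close> and the full-width bars are present.\<close>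
  subgoal by (rule seesI[where t="4 * int k + 4 * int b + 19" and c=SA]) (auto simp: spans_def slots_def)
  subgoal by (rule seesI[where t="-9" and c=SA]) (auto simp: spans_def slots_def)
  subgoal by (rule seesI[where t="-1" and c=SA]) (auto simp: spans_def slots_def)
  subgoal by (rule seesI[where t="4 * int k + 4 * int b + 19" and c=SA]) (auto simp: spans_def slots_def)
  subgoal by (rule seesI[where t="-1" and c=SB]) (auto simp: spans_def slots_def)
  subgoal by (rule seesI[where t="4 * int k + 4 * int b + 19" and c=SB]) (auto simp: spans_def slots_def)
  subgoal by (rule seesI[where t="4 * int b + 8" and c=SB]) (auto simp: spans_def slots_def)
  done

text \<open>At \<open>4 * i + 9\<close> exactly the steps \<open>i\<close>, \<open>i + 1\<close>,
  \<open>i + 2\<close> can be present, so only the middle one is ever passed.\<close>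

lemma sees_path:
  assumes "j < k" "i < j" "j \<le> i + 2"
  shows "sees b k (SP i) (SP j)"
  by (rule seesI[where t="4 * int i + 9" and c="SP (i+1)"]) (use assms in \<open>auto simp: spans_def slots_def\<close>)

text \<open>Both abscissas make step \<open>i\<close> topmost. They keep clear of
  \<open>4 * b + 8\<close>, the only place where \<open>SZ\<close> and \<open>SY\<close> are both
  present, so just one of these two is passed.\<close>

lemma sees_SA:
  assumes "i < k"
  shows "sees b k SA (SP i)"
proof (cases "i \<le> b")
  case True
  show ?thesis
    by (rule seesI[where t="4 * int i + 7" and c=SZ]) (use assms True in \<open>auto simp: spans_def slots_def\<close>)
next
  case False
  show ?thesis
    by (rule seesI[where t="4 * int i + 9" and c=SY]) (use assms False in \<open>auto simp: spans_def slots_def\<close>)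
qed

lemma sees_SB:
  assumes "i < k"
  shows "sees b k (SP i) SB"
  by (rule seesI[where t="4 * int i + 1" and c=SZ]) (use assms in \<open>auto simp: spans_def slots_def\<close>)

lemma sees_SX:
  assumes "i < k"
  shows "sees b k (SP i) SX"
  by (rule seesI[where t="4 * int i + 1" and c=SB]) (use assms in \<open>auto simp: spans_def slots_def\<close>)

lemma sees_SY:
  assumes "i < k" "b \<le> i"
  shows "sees b k SY (SP i)"
  by (rule seesI[where t="4 * int i + 9" and c=SZ]) (use assms in \<open>auto simp: spans_def slots_def\<close>)

lemma sees_SZ:
  assumes "i < k" "i \<le> b + 1"
  shows "sees b k SZ (SP i)"
proof (cases "i \<le> b")
  case True
  show ?thesis
    by (rule seesI[where t="4 * int i + 7" and c=SY]) (use assms True in \<open>auto simp: spans_def slots_def\<close>)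
next
  case False
  \<comment> \<open>Now \<open>i = b + 1\<close>. To the left of the end of \<open>SZ\<close> this
    step is not topmost, but only step \<open>b\<close> is above it. The splitting of a rim vertex
    relies on this one extra step.\<close>
  show ?thesis
    by (rule seesI[where t="4 * int b + 7" and c="SP b"]) (use assms False in \<open>auto simp: spans_def slots_def\<close>)
qed

lemma sees_any:
  assumes "s \<in> {SA, SB, SX}" "s' \<in> slots k" "s \<noteq> s'"
  shows "sees b k s s'"
  using assms sees_full sees_SA sees_SB sees_SX sees_sym unfolding slots_def by auto

section \<open>Realising slots by segments in the plane\<close>

definition slot_bar :: "nat \<Rightarrow> nat \<Rightarrow> slot \<Rightarrow> (real \<times> real) set" where
  "slot_bar b k s = closed_segment (real_of_int (left_end b s), real_of_int (level k s))
     (real_of_int (right_end b k s), real_of_int (level k s))"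

lemma mem_horizontal_segment:
  fixes a b h t q :: real
  assumes "a \<le> b"
  shows "(t, q) \<in> closed_segment (a, h) (b, h) \<longleftrightarrow> a \<le> t \<and> t \<le> b \<and> q = h"
proof -
  have "(t, q) \<in> closed_segment (a, h) (b, h) \<longleftrightarrow> t \<in> closed_segment a b \<and> q = h"
    by (auto simp: in_segment algebra_simps)
  then show ?thesis using assms by (auto simp: closed_segment_eq_real_ivl)
qed

lemma mem_vertical_segment:
  fixes t t' p q h :: real
  shows "(t', h) \<in> closed_segment (t, p) (t, q) \<longleftrightarrow> t' = t \<and> min p q \<le> h \<and> h \<le> max p q"
proof -
  have "(t', h) \<in> closed_segment (t, p) (t, q) \<longleftrightarrow> t' = t \<and> h \<in> closed_segment p q"
    by (auto simp: in_segment algebra_simps)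
  then show ?thesis by (auto simp: closed_segment_eq_real_ivl)
qed

lemma ends_less: "left_end b s < right_end b k s"
  by (cases s) auto

lemma mem_slot_bar:
  "(t, q) \<in> slot_bar b k s \<longleftrightarrow>
     real_of_int (left_end b s) \<le> t \<and> t \<le> real_of_int (right_end b k s) \<and> q = real_of_int (level k s)"
  unfolding slot_bar_def by (rule mem_horizontal_segment) (use ends_less[of b s k] in simp)

lemma bar_1_visible_slots:
  assumes sg: "simple_graph V E" and inj: "inj_on f V" and fV: "f ` V \<subseteq> slots k"
    and vis: "\<And>u w. {u, w} \<in> E \<Longrightarrow> sees b k (f u) (f w)"
  shows "bar_1_visible V E"
proof -
  let ?bar = "\<lambda>w. slot_bar b k (f w)"
  define good where "good u v S \<longleftrightarrow>
      (\<exists>t p q. S = closed_segment (t, p) (t, q) \<and> (t, p) \<in> ?bar u \<and> (t, q) \<in> ?bar v) \<and>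
      card {w \<in> V - {u, v}. S \<inter> ?bar w \<noteq> {}} \<le> 1" for u v S
  have good_sym: "good v u S" if uv: "good u v S" for u v S
  proof -
    obtain t p q where "S = closed_segment (t, q) (t, p)" "(t, q) \<in> ?bar v" "(t, p) \<in> ?bar u"
      using uv closed_segment_commute unfolding good_def by blast
    moreover have "V - {v, u} = V - {u, v}" by blast
    ultimately show ?thesis using uv unfolding good_def by auto
  qed
  have ex_good: "\<exists>S. good u v S" if uv: "{u, v} \<in> E" for u v
  proof -
    have inV: "u \<in> V" "v \<in> V" using sg uv unfolding simple_graph_def by auto
    obtain t c where t: "spans b k t (f u)" "spans b k t (f v)"
      and c: "\<And>w. w \<in> slots k \<Longrightarrow> spans b k t w \<Longrightarrow> w \<noteq> f u \<Longrightarrow> w \<noteq> f v \<Longrightarrow>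
        min (level k (f u)) (level k (f v)) \<le> level k w \<Longrightarrow>
        level k w \<le> max (level k (f u)) (level k (f v)) \<Longrightarrow> w = c"
      using vis[OF uv] unfolding sees_def by blast
    let ?S = "closed_segment (real_of_int t, real_of_int (level k (f u))) (real_of_int t, real_of_int (level k (f v)))"
    have fc: "f w = c" if w: "w \<in> V - {u, v}" and meets: "?S \<inter> ?bar w \<noteq> {}" for w
    proof (rule c)
      obtain t' h where th: "(t', h) \<in> ?S" "(t', h) \<in> ?bar w" using meets by auto
      then have *: "t' = real_of_int t" "h = real_of_int (level k (f w))"
        "min (real_of_int (level k (f u))) (real_of_int (level k (f v))) \<le> h"
        "h \<le> max (real_of_int (level k (f u))) (real_of_int (level k (f v)))"
        "real_of_int (left_end b (f w)) \<le> t'" "t' \<le> real_of_int (right_end b k (f w))"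
        unfolding mem_slot_bar mem_vertical_segment by auto
      show "f w \<in> slots k" using w fV by auto
      show "f w \<noteq> f u" "f w \<noteq> f v" using w inV inj by (auto simp: inj_on_def)
      show "spans b k t (f w)" using * by (simp add: spans_def)
      show "min (level k (f u)) (level k (f v)) \<le> level k (f w)"
        "level k (f w) \<le> max (level k (f u)) (level k (f v))" using * by linarith+
    qed
    have "{w \<in> V - {u, v}. ?S \<inter> ?bar w \<noteq> {}} \<subseteq> {w \<in> V. f w = c}"
      using fc by blast
    moreover have "finite {w \<in> V. f w = c}" using sg by (simp add: simple_graph_def)
    moreover have "card {w \<in> V. f w = c} \<le> 1"
      using inj \<open>finite {w \<in> V. f w = c}\<close> by (subst One_nat_def, subst card_le_Suc0_iff_eq) (auto simp: inj_on_def)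
    ultimately have "card {w \<in> V - {u, v}. ?S \<inter> ?bar w \<noteq> {}} \<le> 1"
      by (meson card_mono le_trans)
    moreover have "(real_of_int t, real_of_int (level k (f u))) \<in> ?bar u"
      "(real_of_int t, real_of_int (level k (f v))) \<in> ?bar v"
      using t by (auto simp: mem_slot_bar spans_def)
    ultimately show ?thesis unfolding good_def by (intro exI[of _ ?S]) blast
  qed
  \<comment> \<open>\<open>seg\<close> takes an unordered edge, so the chosen segment must serve
    both ways of naming its ends; \<open>good_sym\<close> ensures that any segment good for one
    naming does.\<close>
  define seg where "seg e = (SOME S. \<forall>u v. e = {u, v} \<longrightarrow> good u v S)" for e
  have seg: "good u v (seg {u, v})" if uv: "{u, v} \<in> E" for u v
  proof -
    obtain S where S: "good u v S" using ex_good[OF uv] by blast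
    have "\<forall>u' v'. {u, v} = {u', v'} \<longrightarrow> good u' v' S"
    proof (intro allI impI)
      fix u' v' assume "{u, v} = {u', v'}"
      then consider "u' = u" "v' = v" | "u' = v" "v' = u" by (auto simp: doubleton_eq_iff)
      then show "good u' v' S" using S good_sym[OF S] by cases simp_all
    qed
    then have "\<forall>u' v'. {u, v} = {u', v'} \<longrightarrow> good u' v' (seg {u, v})"
      unfolding seg_def by (rule someI)
    then show ?thesis by blast
  qed
  have "is_bar (?bar w)" for w
    unfolding is_bar_def slot_bar_def using ends_less[of b "f w" k] of_int_less_iff by blast
  moreover have "?bar w \<inter> ?bar w' = {}" if "w \<in> V" "w' \<in> V" "w \<noteq> w'" for w w'
  proof -
    have "f w \<noteq> f w'" "f w \<in> slots k" "f w' \<in> slots k"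
      using that inj fV by (auto simp: inj_on_def)
    then have "level k (f w) \<noteq> level k (f w')" using level_inj[of k] by (auto simp: inj_on_def)
    then show ?thesis by (auto simp: mem_slot_bar)
  qed
  ultimately have "bar_1_visibility_drawing V E ?bar seg"
    unfolding bar_1_visibility_drawing_def using seg unfolding good_def by simp
  then show ?thesis using sg unfolding bar_1_visible_def by blast
qed

text \<open>The five names may coincide: in \<open>f\<close> the earlier name wins, so repeating a
  vertex as \<open>Z\<close> leaves \<open>SZ\<close> empty. \<open>Y \<noteq> Z\<close> keeps a
  vertex named \<open>Z\<close> from being absorbed by \<open>SY\<close>.\<close>

lemma bar_1_visible_layout:
  fixes p :: "nat \<Rightarrow> 'a"
  assumes sg: "simple_graph V E"
    and V: "V \<subseteq> {A, B, X, Y, Z} \<union> p ` {..<k}"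
    and inj: "inj_on p {..<k}" and p: "p ` {..<k} \<inter> {A, B, X, Y, Z} = {}"
    and YZ: "Y \<noteq> Z"
    and E: "\<And>e. e \<in> E \<Longrightarrow> A \<in> e \<or> B \<in> e \<or> X \<in> e \<or> e = {Y, Z}
        \<or> (\<exists>i<k. i \<le> b + 1 \<and> e = {Z, p i}) \<or> (\<exists>i<k. b \<le> i \<and> e = {Y, p i})
        \<or> (\<exists>i j. i < j \<and> j \<le> i + 2 \<and> j < k \<and> e = {p i, p j})"
  shows "bar_1_visible V E"
proof -
  define f where "f w = (if w = A then SA else if w = B then SB else if w = X then SX else
    if w = Y then SY else if w = Z then SZ else SP (inv_into {..<k} p w))" for w
  have fp: "f (p i) = SP i" if "i < k" for i
    using that inj p by (auto simp: f_def)
  have fV: "f w \<in> slots k" if wV: "w \<in> V" for w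
  proof (cases "w \<in> {A, B, X, Y, Z}")
    case True
    then show ?thesis by (auto simp: f_def slots_def)
  next
    case False
    then obtain i where "i < k" "w = p i" using wV V by auto
    then show ?thesis using fp[of i] by (auto simp: slots_def)
  qed
  have finj: "inj_on f V"
  proof (rule inj_on_inverseI)
    fix w assume "w \<in> V"
    then consider "w \<in> {A, B, X, Y, Z}" | i where "i < k" "w = p i" using V by auto
    \<comment> \<open>An explicit left inverse replaces a pairwise comparison of the branches of
      \<open>f\<close> and tolerates coinciding names.\<close>
    then show "(case f w of SA \<Rightarrow> A | SB \<Rightarrow> B | SX \<Rightarrow> X | SY \<Rightarrow> Y | SZ \<Rightarrow> Z | SP i \<Rightarrow> p i) = w"
      by cases (simp_all add: fp, auto simp: f_def)
  qed
  have full: "sees b k (f s) (f w)" if "s \<in> {A, B, X}" "s \<in> V" "w \<in> V" "s \<noteq> w" for s w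
  proof (rule sees_any)
    show "f s \<in> {SA, SB, SX}" using that(1) by (auto simp: f_def)
    show "f w \<in> slots k" by (rule fV[OF that(3)])
    show "f s \<noteq> f w" using inj_onD[OF finj _ that(2,3)] that(4) by blast
  qed
  show ?thesis
  proof (rule bar_1_visible_slots[OF sg finj])
    show "f ` V \<subseteq> slots k" using fV by blast
    fix u w assume uw: "{u, w} \<in> E"
    then have uwV: "u \<in> V" "w \<in> V" "u \<noteq> w" using sg unfolding simple_graph_def by fastforce+
    note full' = full[of u w] full[of w u, THEN sees_sym]
    show "sees b k (f u) (f w)"
    proof (cases "u \<in> {A, B, X} \<or> w \<in> {A, B, X}")
      case True
      then show ?thesis using full' uwV by auto
    next
      case False
      have fYZ: "Y \<notin> {A, B, X} \<Longrightarrow> f Y = SY" "Z \<notin> {A, B, X} \<Longrightarrow> f Z = SZ"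
        using YZ by (auto simp: f_def)
      from E[OF uw] False consider "{u, w} = {Y, Z}"
        | i where "i < k" "i \<le> b + 1" "{u, w} = {Z, p i}"
        | i where "i < k" "b \<le> i" "{u, w} = {Y, p i}"
        | i j where "i < j" "j \<le> i + 2" "j < k" "{u, w} = {p i, p j}" by auto
      then show ?thesis
      proof cases
        case 1
        then show ?thesis using False sees_full(10)[of b k] fYZ
          by (auto simp: doubleton_eq_iff intro: sees_sym)
      next
        case 2
        then show ?thesis using False sees_SZ[of i k b] fYZ fp[of i]
          by (auto simp: doubleton_eq_iff intro: sees_sym)
      next
        case 3
        then show ?thesis using False sees_SY[of i k b] fYZ fp[of i]
          by (auto simp: doubleton_eq_iff intro: sees_sym)
      next
        case 4
        then show ?thesis using sees_path[of j k i b] fp[of i] fp[of j]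
          by (auto simp: doubleton_eq_iff intro: sees_sym)
      qed
    qed
  qed
qed

section \<open>The graph of an even pseudo double wheel\<close>

text \<open>\<open>W\<close> runs round the rim with period \<open>m\<close> over all integers, so
  rotations and reflections become substitutions in its argument and neighbours need no modular
  arithmetic.\<close>

definition double_wheel ::
  "nat \<Rightarrow> (int \<Rightarrow> 'a) \<Rightarrow> 'a \<Rightarrow> 'a \<Rightarrow> 'a set \<Rightarrow> 'a set set \<Rightarrow> bool" where
  "double_wheel m W x y V E \<longleftrightarrow>
     m \<ge> 6 \<and> (\<forall>i j. W i = W j \<longleftrightarrow> i mod int m = j mod int m) \<and>
     x \<noteq> y \<and> x \<notin> range W \<and> y \<notin> range W \<and> V = {x, y} \<union> range W \<and>
     E = {{x, W i} | i. True} \<union> {{y, W i} | i. True}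
       \<union> {{W i, W (i + 1)} | i. True} \<union> {{W i, W (i + 2)} | i. True}"

lemma double_wheel_swap: "double_wheel m W x y V E \<Longrightarrow> double_wheel m W y x V E"
  unfolding double_wheel_def by auto

lemma double_wheel_shift:
  assumes "double_wheel m W x y V E"
  shows "double_wheel m (\<lambda>i. W (c + i)) x y V E"
proof -
  have surj: "range (\<lambda>i. F (c + i)) = range F" for F :: "int \<Rightarrow> 'b"
  proof -
    have "F j \<in> range (\<lambda>i. F (c + i))" for j
      using rangeI[of "\<lambda>i. F (c + i)" "j - c"] by simp
    then show ?thesis by auto
  qed
  have 1: "{{z, W (c + i)} | i. True} = {{z, W i} | i. True}" for z
    using surj[of "\<lambda>i. {z, W i}"] by (simp only: simp_thms full_SetCompr_eq)
  have 2: "{{W (c + i), W (c + (i + d))} | i. True} = {{W i, W (i + d)} | i. True}" for d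
    using surj[of "\<lambda>i. {W i, W (i + d)}"] by (simp only: simp_thms full_SetCompr_eq add.assoc)
  have "(c + i) mod int m = (c + j) mod int m \<longleftrightarrow> i mod int m = j mod int m" for i j
    by (simp add: mod_eq_dvd_iff)
  then show ?thesis
    using assms unfolding double_wheel_def 1 2 surj by simp
qed

lemma double_wheel_reflect:
  assumes "double_wheel m W x y V E"
  shows "double_wheel m (\<lambda>i. W (- i)) x y V E"
proof -
  have surj: "range (\<lambda>i. F (- i)) = range F" for F :: "int \<Rightarrow> 'b"
  proof -
    have "F j \<in> range (\<lambda>i. F (- i))" for j
      using rangeI[of "\<lambda>i. F (- i)" "- j"] by simp
    then show ?thesis by auto
  qed
  have 1: "{{z, W (- i)} | i. True} = {{z, W i} | i. True}" for z
    using surj[of "\<lambda>i. {z, W i}"] by (simp only: simp_thms full_SetCompr_eq)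
  \<comment> \<open>Reflection reverses an edge: its starting index becomes
    \<open>- (i + d)\<close>.\<close>
  have 2: "{{W (- i), W (- (i + d))} | i. True} = {{W i, W (i + d)} | i. True}" for d
  proof (intro equalityI subsetI)
    fix e assume "e \<in> {{W (- i), W (- (i + d))} | i. True}"
    then obtain i where "e = {W (- i), W (- (i + d))}" by blast
    then have "e = {W (- (i + d)), W (- (i + d) + d)}" by (simp add: insert_commute add.commute)
    then show "e \<in> {{W i, W (i + d)} | i. True}" by blast
  next
    fix e assume "e \<in> {{W i, W (i + d)} | i. True}"
    then obtain i where "e = {W i, W (i + d)}" by blast
    moreover have "- (- (i + d)) = i + d" "- (- (i + d) + d) = i" by simp_all
    ultimately have "e = {W (- (- (i + d))), W (- (- (i + d) + d))}" by (simp only: insert_commute)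
    then show "e \<in> {{W (- i), W (- (i + d))} | i. True}" by blast
  qed
  have "(- i) mod int m = (- j) mod int m \<longleftrightarrow> i mod int m = j mod int m" for i j
    by (simp add: mod_eq_dvd_iff) (metis dvd_minus_iff minus_diff_eq)
  then show ?thesis
    using assms unfolding double_wheel_def 1 2 surj by simp
qed

context
  fixes m W x y V E
  assumes dw: "double_wheel m W x y V E"
begin

lemma wheel_size: "m \<ge> 6" and W_eq_iff: "W i = W j \<longleftrightarrow> i mod int m = j mod int m"
  and hubs_distinct: "x \<noteq> y" "x \<noteq> W i" "y \<noteq> W i" "W i \<noteq> x" "W i \<noteq> y"
  and wheel_vertices: "V = {x, y} \<union> range W"
  using dw unfolding double_wheel_def by auto

lemma rim_representative:
  obtains j where "s \<le> j" "j < s + int m" "W i = W j"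
proof
  show "s \<le> s + (i - s) mod int m" "s + (i - s) mod int m < s + int m" using wheel_size by auto
  show "W i = W (s + (i - s) mod int m)" by (simp add: W_eq_iff mod_simps)
qed

lemma W_periodic: "W (i + int m) = W i" "W (i - int m) = W i"
  by (simp_all add: W_eq_iff)

lemma W_inj:
  assumes "\<bar>i - j\<bar> < int m"
  shows "W i = W j \<longleftrightarrow> i = j"
proof
  assume "W i = W j"
  then have "int m dvd i - j" by (simp add: W_eq_iff mod_eq_dvd_iff)
  then show "i = j" using assms zdvd_imp_le[of "int m" "\<bar>i - j\<bar>"] by fastforce
qed simp


lemma edge_at_x: "e \<in> E \<Longrightarrow> x \<in> e \<Longrightarrow> \<exists>i. e = {x, W i}"
  and edge_at_y: "e \<in> E \<Longrightarrow> y \<in> e \<Longrightarrow> \<exists>i. e = {y, W i}"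
  using dw unfolding double_wheel_def by auto

lemma wheel_adjacent:
  "{x, W i} \<in> E" "{y, W i} \<in> E" "{W i, W (i + 1)} \<in> E" "{W i, W (i + 2)} \<in> E"
  using dw unfolding double_wheel_def by auto

text \<open>With the lower index taken in the window of length \<open>m\<close> from
  \<open>s\<close>, a step of length at most 2 can leave the window only to \<open>s + m\<close> or
  \<open>s + m + 1\<close>. These indices name the excluded vertices again, so no remaining edge
  wraps around.\<close>

lemma edges_avoiding:
  assumes e: "e \<in> E" "x \<notin> e" "W s \<notin> e" "W (s + 1) \<notin> e"
  shows "(\<exists>i<m - 2. e = {y, W (s + 2 + int i)}) \<or>
    (\<exists>i j. i < j \<and> j \<le> i + 2 \<and> j < m - 2 \<and> e = {W (s + 2 + int i), W (s + 2 + int j)})"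
proof -
  have rim: ?thesis if ed: "e = {W i, W (i + d)}" "d = 1 \<or> d = 2" for i d
  proof -
    obtain j where j: "s \<le> j" "j < s + int m" "W i = W j" by (rule rim_representative)
    have "W (i + d) = W (j + d)" using j(3) by (metis W_eq_iff mod_add_cong)
    then have e': "e = {W j, W (j + d)}" using ed j by simp
    have "j \<noteq> s" "j \<noteq> s + 1" using e e' by auto
    moreover have "j + d \<noteq> s + int m" "j + d \<noteq> s + 1 + int m"
      using e e' W_periodic by fastforce+
    ultimately have "nat (j - s - 2) < nat (j + d - s - 2)" "nat (j + d - s - 2) \<le> nat (j - s - 2) + 2"
      "nat (j + d - s - 2) < m - 2"
      "W (s + 2 + int (nat (j - s - 2))) = W j" "W (s + 2 + int (nat (j + d - s - 2))) = W (j + d)"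
      using j ed(2) by auto
    then show ?thesis using e' by metis
  qed
  from e consider i where "e = {y, W i}" | i d where "e = {W i, W (i + d)}" "d = 1 \<or> d = 2"
    using dw unfolding double_wheel_def by blast
  then show ?thesis
  proof cases
    case 1
    obtain j where j: "s \<le> j" "j < s + int m" "W i = W j" by (rule rim_representative)
    have "j \<noteq> s" "j \<noteq> s + 1" using e 1 j by auto
    then have "nat (j - s - 2) < m - 2" "W (s + 2 + int (nat (j - s - 2))) = W j" using j by auto
    then show ?thesis using 1 j by metis
  qed (use rim in blast)
qed

lemma vertices_from: "V \<subseteq> {x, y, W s, W (s + 1)} \<union> (\<lambda>i. W (s + 2 + int i)) ` {..<m - 2}"
proof -
  have "W i \<in> {W s, W (s + 1)} \<union> (\<lambda>i. W (s + 2 + int i)) ` {..<m - 2}" for i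
  proof -
    obtain j where j: "s \<le> j" "j < s + int m" "W i = W j" by (rule rim_representative)
    consider "j = s" | "j = s + 1" | "nat (j - s - 2) < m - 2" "j = s + 2 + int (nat (j - s - 2))"
      using j by linarith
    then show ?thesis
    proof cases
      case 3
      then have "W i = W (s + 2 + int (nat (j - s - 2)))" using j(3) by simp
      then show ?thesis using 3(1) by blast
    qed (simp_all add: j(3))
  qed
  then show ?thesis unfolding wheel_vertices by blast
qed

lemma double_wheel_simple: "simple_graph V E"
proof -
  have "range W \<subseteq> {W (-2), W (-1)} \<union> (\<lambda>i. W (int i)) ` {..<m - 2}"
    using vertices_from[of "-2"] hubs_distinct unfolding wheel_vertices by auto
  then have "finite (range W)" by (rule finite_subset) simp
  then have "finite V" unfolding wheel_vertices by simp
  moreover have "W i \<noteq> W (i + 1)" "W i \<noteq> W (i + 2)" for i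
    using W_inj wheel_size by auto
  ultimately show ?thesis
    using dw hubs_distinct unfolding simple_graph_def double_wheel_def by auto
qed

text \<open>With \<open>b = 0\<close> the slot of \<open>y\<close> sees every step. Taking
  \<open>W 0\<close> again for \<open>Z\<close> leaves \<open>SZ\<close> empty.\<close>

lemma double_wheel_visible: "bar_1_visible V E"
proof (rule bar_1_visible_layout[where A="W (-1)" and B="W 0" and X=x and Y=y and Z="W 0" and b=0
      and p="\<lambda>i. W (1 + int i)" and k="m - 2"])
  show "simple_graph V E" by (rule double_wheel_simple)
  show "V \<subseteq> {W (-1), W 0, x, y, W 0} \<union> (\<lambda>i. W (1 + int i)) ` {..<m - 2}"
    using vertices_from[of "-1"] by auto
  show "inj_on (\<lambda>i. W (1 + int i)) {..<m - 2}"
    by (rule inj_onI) (use W_inj in force)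
  show "(\<lambda>i. W (1 + int i)) ` {..<m - 2} \<inter> {W (-1), W 0, x, y, W 0} = {}"
    using W_inj wheel_size hubs_distinct by (auto simp del: W_eq_iff)
  show "y \<noteq> W 0" by (rule hubs_distinct)
  fix e assume "e \<in> E"
  then show "W (-1) \<in> e \<or> W 0 \<in> e \<or> x \<in> e \<or> e = {y, W 0} \<or>
      (\<exists>i<m - 2. i \<le> 0 + 1 \<and> e = {W 0, W (1 + int i)}) \<or>
      (\<exists>i<m - 2. 0 \<le> i \<and> e = {y, W (1 + int i)}) \<or>
      (\<exists>i j. i < j \<and> j \<le> i + 2 \<and> j < m - 2 \<and> e = {W (1 + int i), W (1 + int j)})"
    using edges_avoiding[of e "-1"] by auto
qed

end

text \<open>The edges are grouped by the copy that receives them, which treats both copies alike: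
  \<open>S\<close> and \<open>T\<close> are the neighbours on the two sides, and the separators
  \<open>v2\<close>, \<open>v3\<close> go to both.\<close>

definition split_edges ::
  "'a set set \<Rightarrow> 'a \<Rightarrow> 'a \<Rightarrow> 'a \<Rightarrow> 'a \<Rightarrow> 'a set \<Rightarrow> 'a set \<Rightarrow> 'a set set" where
  "split_edges E v1 v4 v2 v3 S T = {e \<in> E. v1 \<notin> e} \<union> {{v1, w} | w. w \<in> S \<union> {v2, v3}}
     \<union> {{v4, w} | w. w \<in> T \<union> {v2, v3}} \<union> {{v1, v4}, {v2, v3}}"

lemma split_edges_sym: "split_edges E v1 v4 v2 v3 S T = split_edges E v1 v4 v3 v2 S T"
  unfolding split_edges_def by (simp add: insert_commute)

section \<open>Slot assignments for the split wheels\<close>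

context
  fixes m W x y V E v4 V' E'
  assumes dw: "double_wheel m W x y V E"
    and sg: "simple_graph V' E'" and v4: "v4 \<notin> V" and V': "V' = insert v4 V"
begin

lemma v4_new: "v4 \<noteq> x" "v4 \<noteq> y" "v4 \<noteq> W i" "x \<noteq> v4" "y \<noteq> v4" "W i \<noteq> v4"
  using v4 wheel_vertices[OF dw] by auto

text \<open>The separator \<open>W 0\<close> is a full-width bar, which settles its edges to both
  halves and the new edge between the separators. The other one, \<open>W (b + 1)\<close>, is step
  \<open>b\<close> unless it is \<open>W (-1)\<close>; this is the step visible from both
  \<open>SZ\<close> and \<open>SY\<close>.\<close>

lemma hub_splitting_visible:
  assumes b: "b + 1 < m"
    and S: "S \<subseteq> (\<lambda>i. W (int i)) ` {0..b + 1}" and T: "T \<subseteq> (\<lambda>i. W (int i)) ` {b + 1..<m}"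
    and E': "E' \<subseteq> split_edges E x v4 (W 0) (W (int b + 1)) S T"
  shows "bar_1_visible V' E'"
proof (rule bar_1_visible_layout[where A="W (-1)" and B="W 0" and X=y and Y=v4 and Z=x and b=b
      and p="\<lambda>i. W (1 + int i)" and k="m - 2"])
  note [simp] = hubs_distinct[OF dw] v4_new
  show "simple_graph V' E'" by (rule sg)
  show "V' \<subseteq> {W (-1), W 0, y, v4, x} \<union> (\<lambda>i. W (1 + int i)) ` {..<m - 2}"
    using vertices_from[OF dw, of "-1"] unfolding V' by auto
  show "inj_on (\<lambda>i. W (1 + int i)) {..<m - 2}"
    by (rule inj_onI) (use W_inj[OF dw] in force)
  show "(\<lambda>i. W (1 + int i)) ` {..<m - 2} \<inter> {W (-1), W 0, y, v4, x} = {}"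
    using W_inj[OF dw] wheel_size[OF dw] by auto
  show "v4 \<noteq> x" by simp
  \<comment> \<open>Index \<open>m - 1\<close> is beyond the path; it names the full-width bar
    \<open>W (-1)\<close>.\<close>
  have last: "W (int m - 1) = W (-1)" using W_periodic(1)[OF dw, of "-1"] by simp
  have left: "(\<exists>i<m - 2. i \<le> b + 1 \<and> e = {x, W (1 + int i)}) \<or> W (-1) \<in> e \<or> W 0 \<in> e"
    if ei: "e = {x, W (int i)}" "i \<le> b + 1" for e i
  proof -
    consider "i = 0" | "i = m - 1" | "i - 1 < m - 2" "int i = 1 + int (i - 1)" using ei b by linarith
    then show ?thesis
    proof cases
      case 2
      then show ?thesis using last that wheel_size[OF dw] by (simp add: of_nat_diff)
    next
      case 3
      have "e = {x, W (1 + int (i - 1))}" using ei(1) unfolding 3(2)[symmetric] .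
      then show ?thesis using 3(1) ei(2) by (intro disjI1 exI[of _ "i - 1"]) simp
    qed (use that in auto)
  qed
  have right: "(\<exists>i<m - 2. b \<le> i \<and> e = {v4, W (1 + int i)}) \<or> W (-1) \<in> e \<or> W 0 \<in> e"
    if ei: "e = {v4, W (int i)}" "b + 1 \<le> i" "i < m" for e i
  proof -
    consider "i = m - 1" | "i - 1 < m - 2" "int i = 1 + int (i - 1)" "b \<le> i - 1" using ei by linarith
    then show ?thesis
    proof cases
      case 1
      then show ?thesis using last that wheel_size[OF dw] by (simp add: of_nat_diff)
    next
      case 2
      have "e = {v4, W (1 + int (i - 1))}" using ei(1) unfolding 2(2)[symmetric] .
      then show ?thesis using 2(1,3) by (intro disjI1 exI[of _ "i - 1"]) simp
    qed
  qed
  fix e assume "e \<in> E'"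
  with E' have "e \<in> split_edges E x v4 (W 0) (W (int b + 1)) S T" by blast
  then have "(e \<in> E \<and> x \<notin> e) \<or> (\<exists>w. w \<in> S \<union> {W 0, W (int b + 1)} \<and> e = {x, w}) \<or>
      (\<exists>w. w \<in> T \<union> {W 0, W (int b + 1)} \<and> e = {v4, w}) \<or> e = {x, v4} \<or> e = {W 0, W (int b + 1)}"
    unfolding split_edges_def by blast
  then consider "e \<in> E" "x \<notin> e" | w where "w \<in> S" "e = {x, w}" | "e = {x, W (int b + 1)}"
    | w where "w \<in> T" "e = {v4, w}" | "e = {v4, W (int b + 1)}" | "W 0 \<in> e" | "e = {v4, x}"
    by (elim disjE exE conjE UnE insertE emptyE) (simp_all add: insert_commute)
  then show "W (-1) \<in> e \<or> W 0 \<in> e \<or> y \<in> e \<or> e = {v4, x} \<or>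
      (\<exists>i<m - 2. i \<le> b + 1 \<and> e = {x, W (1 + int i)}) \<or>
      (\<exists>i<m - 2. b \<le> i \<and> e = {v4, W (1 + int i)}) \<or>
      (\<exists>i j. i < j \<and> j \<le> i + 2 \<and> j < m - 2 \<and> e = {W (1 + int i), W (1 + int j)})"
  proof cases
    case 1
    then show ?thesis using edges_avoiding[OF dw, of e "-1"] by auto
  next
    case 2
    then obtain i where "i \<le> b + 1" "e = {x, W (int i)}" using subsetD[OF S] by force
    then show ?thesis using left by blast
  next
    case 3
    then have "e = {x, W (int (b + 1))}" by (simp add: add.commute)
    then show ?thesis using left by blast
  next
    case 4
    then obtain i where "b + 1 \<le> i" "i < m" "e = {v4, W (int i)}" using subsetD[OF T] by force
    then show ?thesis using right by blast
  next
    case 5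
    then have "e = {v4, W (int (b + 1))}" by (simp add: add.commute)
    then show ?thesis using right b by blast
  qed auto
qed

text \<open>One copy of the split vertex is a full-width bar, the other an additional step in front
  of \<open>W 2\<close>. Among the steps \<open>v4\<close> has only the neighbour
  \<open>W 2\<close>, since \<open>W 1\<close> is full-width as well.\<close>

lemma rim_splitting_at_hubs_visible:
  assumes E': "E' \<subseteq> split_edges E (W 0) v4 x y {W (-1), W (-2)} {W 1, W 2}"
  shows "bar_1_visible V' E'"
proof (rule bar_1_visible_layout[where A="W 0" and B="W 1" and X=x and Y=y and Z="W 0" and b=0
      and p="\<lambda>i. if i = 0 then v4 else W (1 + int i)" and k="m - 1"])
  let ?p = "\<lambda>i. if i = 0 then v4 else W (1 + int i)"
  note [simp] = hubs_distinct[OF dw] v4_new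
  show "simple_graph V' E'" by (rule sg)
  have p_Suc: "W (2 + int i) = ?p (i + 1)" for i by simp
  have "W (2 + int i) \<in> ?p ` {..<m - 1}" if "i < m - 2" for i
    unfolding p_Suc by (rule imageI) (use that in simp)
  moreover have "v4 \<in> ?p ` {..<m - 1}" using wheel_size[OF dw] by (intro image_eqI[of _ _ 0]) auto
  ultimately show "V' \<subseteq> {W 0, W 1, x, y, W 0} \<union> ?p ` {..<m - 1}"
    using vertices_from[OF dw, of 0] unfolding V' by auto
  show "inj_on ?p {..<m - 1}"
  proof (rule inj_onI)
    fix i j assume "i \<in> {..<m - 1}" "j \<in> {..<m - 1}" "?p i = ?p j"
    then show "i = j" using W_inj[OF dw, of "1 + int i" "1 + int j"] by (auto split: if_splits)
  qed
  show "?p ` {..<m - 1} \<inter> {W 0, W 1, x, y, W 0} = {}"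
    using W_inj[OF dw] wheel_size[OF dw] by auto
  show "y \<noteq> W 0" by simp
  have path: "\<exists>i j. i < j \<and> j \<le> i + 2 \<and> j < m - 1 \<and> e = {?p i, ?p j}"
    if "i < j" "j \<le> i + 2" "j < m - 2" "e = {W (2 + int i), W (2 + int j)}" for e i j
    using that unfolding p_Suc by (intro exI[of _ "i + 1"] exI[of _ "j + 1"]) auto
  have spoke: "\<exists>i<m - 1. 0 \<le> i \<and> e = {y, ?p i}" if "i < m - 2" "e = {y, W (2 + int i)}" for e i
    using that unfolding p_Suc by (intro exI[of _ "i + 1"]) auto
  fix e assume e: "e \<in> E'"
  have new_path: "\<exists>i j. i < j \<and> j \<le> i + 2 \<and> j < m - 1 \<and> e = {?p i, ?p j}" if "e = {v4, W 2}"
    using that wheel_size[OF dw] by (intro exI[of _ 0] exI[of _ 1]) auto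
  have new_spoke: "\<exists>i<m - 1. 0 \<le> i \<and> e = {y, ?p i}" if "e = {v4, y}"
    using that wheel_size[OF dw] by (intro exI[of _ 0]) auto
  from e E' have "e \<in> split_edges E (W 0) v4 x y {W (-1), W (-2)} {W 1, W 2}" by blast
  then have "e \<in> E \<or> (\<exists>w. e = {W 0, w}) \<or>
      (\<exists>w. w \<in> {W 1, W 2} \<union> {x, y} \<and> e = {v4, w}) \<or> e = {x, y}"
    unfolding split_edges_def by blast
  then consider "e \<in> E" | "W 0 \<in> e \<or> W 1 \<in> e \<or> x \<in> e" | "e = {v4, W 2}" | "e = {v4, y}"
    by (elim disjE exE conjE UnE insertE emptyE) simp_all
  then show "W 0 \<in> e \<or> W 1 \<in> e \<or> x \<in> e \<or> e = {y, W 0} \<or>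
      (\<exists>i<m - 1. i \<le> 0 + 1 \<and> e = {W 0, ?p i}) \<or>
      (\<exists>i<m - 1. 0 \<le> i \<and> e = {y, ?p i}) \<or>
      (\<exists>i j. i < j \<and> j \<le> i + 2 \<and> j < m - 1 \<and> e = {?p i, ?p j})"
  proof cases
    case 1
    show ?thesis
    proof (cases "W 0 \<in> e \<or> W 1 \<in> e \<or> x \<in> e")
      case False
      then have "(\<exists>i<m - 2. e = {y, W (2 + int i)}) \<or>
        (\<exists>i j. i < j \<and> j \<le> i + 2 \<and> j < m - 2 \<and> e = {W (2 + int i), W (2 + int j)})"
        using edges_avoiding[OF dw, of e 0] 1 by simp
      then show ?thesis using path spoke by metis
    qed blast
  qed (use new_path new_spoke in blast)+
qed

text \<open>\<open>P\<close> is the copy on the side of \<open>x\<close>, \<open>Q\<close> the one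
  on the side of \<open>y\<close>; the separators are \<open>W a\<close> and \<open>W 2\<close>, so
  \<open>W 1\<close> stays with \<open>P\<close>. \<open>P\<close> replaces \<open>W 0\<close> as
  step 0. Having lost \<open>y\<close>, it lets \<open>SY\<close> start at step 1, hence
  \<open>b = 1\<close>. \<open>Q\<close> in \<open>SZ\<close> must see steps 0 and 2, and 2 is just
  \<open>b + 1\<close>.\<close>

lemma rim_splitting_visible:
  assumes PQ: "{P, Q} = {W 0, v4}" and a: "a = -1 \<or> a = -2"
    and E': "E' \<subseteq> {e \<in> E. W 0 \<notin> e} \<union> {{P, w} | w. w \<in> {x, W (-1), W (-2), W 1, W 2, Q}}
      \<union> {{Q, w} | w. w \<in> {y, W (-1), W (-2), W 2}} \<union> {{W a, W 2}}"
  shows "bar_1_visible V' E'"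
proof (rule bar_1_visible_layout[where A="W (-2)" and B="W (-1)" and X=x and Y=y and Z=Q and b=1
      and p="\<lambda>i. if i = 0 then P else W (int i)" and k="m - 2"])
  let ?p = "\<lambda>i. if i = 0 then P else W (int i)"
  note [simp] = hubs_distinct[OF dw] v4_new
  have m: "m \<ge> 6" by (rule wheel_size[OF dw])
  have W0: "W i \<noteq> W 0" if "\<bar>i\<bar> < int m" "i \<noteq> 0" for i using W_inj[OF dw, of i 0] that by simp
  have new: "P \<noteq> Q" "P \<in> {W 0, v4}" "Q \<in> {W 0, v4}" using PQ v4_new by (auto simp: doubleton_eq_iff)
  have PQ_W: "W i \<noteq> P" "W i \<noteq> Q" if "\<bar>i\<bar> < int m" "i \<noteq> 0" for i
    using new W0[OF that] by auto
  have PQ_hubs: "P \<noteq> x" "P \<noteq> y" "Q \<noteq> x" "Q \<noteq> y" using new by auto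
  show "simple_graph V' E'" by (rule sg)
  define G where "G = ?p ` {..<m - 2}"
  have "W (int i) \<in> {W 0} \<union> G" if "i < m - 2" for i
  proof (cases "i = 0")
    case False
    then have "W (int i) = ?p i" by simp
    then show ?thesis using that unfolding G_def by blast
  qed simp
  then have "V \<subseteq> {x, y, W (-2), W (-1), W 0} \<union> G"
    using vertices_from[OF dw, of "-2"] by auto
  moreover have "P \<in> G" unfolding G_def using m by (intro image_eqI[of _ _ 0]) auto
  then have "{W 0, v4} \<subseteq> {Q} \<union> G" unfolding PQ[symmetric] by simp
  ultimately show "V' \<subseteq> {W (-2), W (-1), x, y, Q} \<union> ?p ` {..<m - 2}"
    unfolding V' G_def[symmetric] by blast
  show "inj_on ?p {..<m - 2}"
  proof (rule inj_onI)
    fix i j assume ij: "i \<in> {..<m - 2}" "j \<in> {..<m - 2}" "?p i = ?p j"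
    then have less: "\<bar>int i\<bar> < int m" "\<bar>int j\<bar> < int m" "\<bar>int i - int j\<bar> < int m" by auto
    show "i = j"
    proof (cases "i = 0 \<or> j = 0")
      case True
      then show ?thesis using ij(3) PQ_W(1)[OF less(1)] PQ_W(1)[OF less(2)] by (metis of_nat_eq_0_iff)
    next
      case False
      then show ?thesis using ij(3) W_inj[OF dw less(3)] by simp
    qed
  qed
  have "?p i \<notin> {W (-2), W (-1), x, y, Q}" if "i < m - 2" for i
  proof (cases "i = 0")
    case True
    then show ?thesis using PQ_W(1)[of "-1"] PQ_W(1)[of "-2"] PQ_hubs new(1) m by auto
  next
    case False
    then show ?thesis
      using W_inj[OF dw, of "int i" "-1"] W_inj[OF dw, of "int i" "-2"] PQ_W(2)[of "int i"] that m by auto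
  qed
  then show "?p ` {..<m - 2} \<inter> {W (-2), W (-1), x, y, Q} = {}" by blast
  show "y \<noteq> Q" using PQ_hubs by simp
  fix e assume e: "e \<in> E'"
  have path: "\<exists>i j. i < j \<and> j \<le> i + 2 \<and> j < m - 2 \<and> e = {?p i, ?p j}"
    if "e = {P, W 1} \<or> e = {P, W 2}"
    using that
  proof
    assume "e = {P, W 1}"
    then show ?thesis using m by (intro exI[of _ 0] exI[of _ 1]) auto
  next
    assume "e = {P, W 2}"
    then show ?thesis using m by (intro exI[of _ 0] exI[of _ 2]) auto
  qed
  have zP: "\<exists>i<m - 2. i \<le> 1 + 1 \<and> e = {Q, ?p i}" if "e = {P, Q} \<or> e = {Q, W 2}"
    using that
  proof
    assume "e = {P, Q}"
    then show ?thesis using m by (intro exI[of _ 0]) auto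
  next
    assume "e = {Q, W 2}"
    then show ?thesis using m by (intro exI[of _ 2]) auto
  qed
  from subsetD[OF E' e] have "(e \<in> E \<and> W 0 \<notin> e) \<or>
      (\<exists>w. w \<in> {x, W (-1), W (-2), W 1, W 2, Q} \<and> e = {P, w}) \<or>
      (\<exists>w. w \<in> {y, W (-1), W (-2), W 2} \<and> e = {Q, w}) \<or> e = {W a, W 2}" by blast
  then have "(e \<in> E \<and> W 0 \<notin> e) \<or> (W (-2) \<in> e \<or> W (-1) \<in> e \<or> x \<in> e) \<or>
      (e = {P, W 1} \<or> e = {P, W 2}) \<or> (e = {P, Q} \<or> e = {Q, W 2}) \<or> e = {y, Q}"
    using a by (elim disjE exE conjE) auto
  then consider "e \<in> E" "W 0 \<notin> e" | "W (-2) \<in> e \<or> W (-1) \<in> e \<or> x \<in> e" | "e = {P, W 1} \<or> e = {P, W 2}"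
    | "e = {P, Q} \<or> e = {Q, W 2}" | "e = {y, Q}"
    by argo
  then show "W (-2) \<in> e \<or> W (-1) \<in> e \<or> x \<in> e \<or> e = {y, Q} \<or>
      (\<exists>i<m - 2. i \<le> 1 + 1 \<and> e = {Q, ?p i}) \<or>
      (\<exists>i<m - 2. 1 \<le> i \<and> e = {y, ?p i}) \<or>
      (\<exists>i j. i < j \<and> j \<le> i + 2 \<and> j < m - 2 \<and> e = {?p i, ?p j})"
  proof cases
    case 1
    show ?thesis
    proof (cases "W (-2) \<in> e \<or> W (-1) \<in> e \<or> x \<in> e")
      case False
      then consider i where "i < m - 2" "e = {y, W (int i)}"
        | i j where "i < j" "j \<le> i + 2" "j < m - 2" "e = {W (int i), W (int j)}"
        using edges_avoiding[OF dw, of e "-2"] 1 by auto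
      then show ?thesis
      proof cases
        fix i assume i: "i < m - 2" "e = {y, W (int i)}"
        \<comment> \<open>Step 0 holds \<open>P\<close> in place of \<open>W 0\<close>, and the old
          edges at \<open>W 0\<close> are excluded here.\<close>
        then have "i \<noteq> 0" using 1 by (intro notI) auto
        then show ?thesis using i by (metis One_nat_def Suc_leI neq0_conv)
      next
        fix i j assume ij: "i < j" "j \<le> i + 2" "j < m - 2" "e = {W (int i), W (int j)}"
        then have "i \<noteq> 0" using 1 by (intro notI) auto
        then have "e = {?p i, ?p j}" using ij by simp
        then show ?thesis using ij by blast
      qed
    qed blast
  qed (use path zP in blast)+
qed

end

section \<open>Splittings of even pseudo double wheels\<close>

lemma rotate_map_upt:
  assumes "\<And>i. g (i + m) = g i"
  shows "rotate k (map g [0..<m]) = map (\<lambda>i. g (i + k)) [0..<m]"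
proof (rule nth_equalityI)
  fix i assume "i < length (rotate k (map g [0..<m]))"
  then have i: "i < m" by simp
  have "g (j mod m + n * m) = g (j mod m)" for j n
    by (induction n) (simp, metis add.assoc add.commute assms mult_Suc)
  then have "g (j mod m) = g j" for j by (metis mod_div_mult_eq)
  then show "rotate k (map g [0..<m]) ! i = map (\<lambda>i. g (i + k)) [0..<m] ! i"
    using i by (simp add: nth_rotate add.commute)
qed simp

lemma rotate_six:
  "rotate k [a, b, c, d, e, f] \<in>
    {[a, b, c, d, e, f], [b, c, d, e, f, a], [c, d, e, f, a, b],
     [d, e, f, a, b, c], [e, f, a, b, c, d], [f, a, b, c, d, e]}"
proof -
  have "rotate k [a, b, c, d, e, f] = rotate (k mod 6) [a, b, c, d, e, f]"
    by (subst rotate_conv_mod) simp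
  moreover have "k mod 6 = 0 \<or> k mod 6 = Suc 0 \<or> k mod 6 = Suc (Suc 0) \<or> k mod 6 = Suc (Suc (Suc 0)) \<or>
      k mod 6 = Suc (Suc (Suc (Suc 0))) \<or> k mod 6 = Suc (Suc (Suc (Suc (Suc 0))))"
    using mod_less_divisor[of 6 k] by linarith
  ultimately show ?thesis by (elim disjE) simp_all
qed

lemma split_list_six:
  assumes "[a, b, c, d, e, f] = p # us @ q # vs"
  shows "p = a \<and> (q, us, vs) \<in>
    {(b, [], [c, d, e, f]), (c, [b], [d, e, f]), (d, [b, c], [e, f]), (e, [b, c, d], [f]), (f, [b, c, d, e], [])}"
  using assms by (auto simp: Cons_eq_append_conv)

context
  fixes m W x y V E v4 V' E'
  assumes dw: "double_wheel m W x y V E"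
    and sg: "simple_graph V' E'" and v4: "v4 \<notin> V" and V': "V' = insert v4 V"
begin

text \<open>Rotating the list of neighbours by \<open>k\<close> is a shift of the rim indices by
  \<open>k\<close>, after which the separators have the indices 0 and
  \<open>length ws + 1\<close>.\<close>

lemma hub_splitting:
  assumes rot: "rotate k (map (\<lambda>i. W (int i)) [0..<m]) = v2 # ws @ v3 # ws'"
    and E': "E' \<subseteq> split_edges E x v4 v2 v3 (set ws) (set ws')"
  shows "bar_1_visible V' E'"
proof -
  let ?W = "\<lambda>i. W (int k + i)"
  have dw': "double_wheel m ?W x y V E" by (rule double_wheel_shift[OF dw])
  let ?b = "length ws"
  have W_add: "W (int (i + m)) = W (int i)" for i
    using W_periodic(1)[OF dw, of "int i"] by simp
  have list: "v2 # ws @ v3 # ws' = map (\<lambda>i. ?W (int i)) [0..<m]"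
    unfolding rot[symmetric] rotate_map_upt[of "\<lambda>i. W (int i)", OF W_add] by (simp add: add.commute)
  have len: "m = ?b + length ws' + 2" using arg_cong[OF list, of length] by simp
  have nth: "(v2 # ws @ v3 # ws') ! i = ?W (int i)" if "i < m" for i
    using that unfolding list by simp
  have v2: "v2 = ?W 0" using nth[of 0] len by simp
  have v3: "v3 = ?W (int ?b + 1)" using nth[of "?b + 1"] len by (simp add: add.commute)
  have ws: "set ws \<subseteq> (\<lambda>i. ?W (int i)) ` {0..?b + 1}"
  proof
    fix w assume "w \<in> set ws"
    then obtain i where "i < ?b" "w = ws ! i" by (auto simp: in_set_conv_nth)
    then have "w = ?W (int (i + 1))" "i + 1 \<in> {0..?b + 1}"
      using nth[of "i + 1"] len by (auto simp: nth_append)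
    then show "w \<in> (\<lambda>i. ?W (int i)) ` {0..?b + 1}" by blast
  qed
  have ws': "set ws' \<subseteq> (\<lambda>i. ?W (int i)) ` {?b + 1..<m}"
  proof
    fix w assume "w \<in> set ws'"
    then obtain i where "i < length ws'" "w = ws' ! i" by (auto simp: in_set_conv_nth)
    then have "w = ?W (int (?b + 2 + i))" "?b + 2 + i \<in> {?b + 1..<m}"
      using nth[of "?b + 2 + i"] len by (auto simp: nth_append)
    then show "w \<in> (\<lambda>i. ?W (int i)) ` {?b + 1..<m}" by blast
  qed
  show ?thesis
    by (rule hub_splitting_visible[OF dw' sg v4 V' _ ws ws'])
      (use E' len in \<open>simp_all add: v2 v3 add.assoc\<close>)
qed

lemma rim_splitting:
  assumes rot: "rotate k [y, W (-2), W (-1), x, W 1, W 2] = v2 # ws @ v3 # ws'"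
    and E': "E' \<subseteq> split_edges E (W 0) v4 v2 v3 (set ws) (set ws')"
    and nonadj: "{v2, v3} \<notin> E"
  shows "bar_1_visible V' E'"
proof -
  let ?W = "\<lambda>i. W (- i)"
  have dw': "double_wheel m ?W x y V E" by (rule double_wheel_reflect[OF dw])
  have adj: "{y, W i} \<in> E" "{W i, y} \<in> E" "{x, W i} \<in> E" "{W i, x} \<in> E" for i
    using wheel_adjacent(1,2)[OF dw] by (simp_all add: insert_commute)
  have adj': "{W (-2), W (-1)} \<in> E" "{W (-1), W (-2)} \<in> E" "{W (-1), W 1} \<in> E" "{W 1, W (-1)} \<in> E"
     "{W 1, W 2} \<in> E" "{W 2, W 1} \<in> E"
    using wheel_adjacent(3)[OF dw, of "-2"] wheel_adjacent(4)[OF dw, of "-1"] wheel_adjacent(3)[OF dw, of 1]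
    by (simp_all add: insert_commute)
  note rim = rim_splitting_visible[OF dw sg v4 V'] and rim' = rim_splitting_visible[OF dw' sg v4 V']
  have "v2 # ws @ v3 # ws' \<in>
    {[y, W (-2), W (-1), x, W 1, W 2], [W (-2), W (-1), x, W 1, W 2, y],
     [W (-1), x, W 1, W 2, y, W (-2)], [x, W 1, W 2, y, W (-2), W (-1)],
     [W 1, W 2, y, W (-2), W (-1), x], [W 2, y, W (-2), W (-1), x, W 1]}"
    unfolding rot[symmetric] by (rule rotate_six)
  then have "(v2, v3, ws, ws') \<in>
    {(y, x, [W (-2), W (-1)], [W 1, W 2]), (x, y, [W 1, W 2], [W (-2), W (-1)]),
     (W (-2), W 1, [W (-1), x], [W 2, y]), (W 1, W (-2), [W 2, y], [W (-1), x]),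
     (W (-2), W 2, [W (-1), x, W 1], [y]), (W 2, W (-2), [y], [W (-1), x, W 1]),
     (W (-1), W 2, [x, W 1], [y, W (-2)]), (W 2, W (-1), [y, W (-2)], [x, W 1])}"
    using nonadj adj adj'
    by - (elim insertE emptyE; drule split_list_six[OF sym]; elim conjE insertE emptyE; simp)
  then show ?thesis
  proof (elim insertE emptyE)
    assume "(v2, v3, ws, ws') = (y, x, [W (-2), W (-1)], [W 1, W 2])"
    then show ?thesis using E'
      by (intro rim_splitting_at_hubs_visible[OF dw sg v4 V']) (simp add: split_edges_sym insert_commute)
  next
    assume "(v2, v3, ws, ws') = (x, y, [W 1, W 2], [W (-2), W (-1)])"
    then show ?thesis using E'
      by (intro rim_splitting_at_hubs_visible[OF dw' sg v4 V']) (simp add: insert_commute)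
  next
    \<comment> \<open>The reflected indexing turns these separators into those with indices 2 and
      -1. Exchanging \<open>v2\<close> and \<open>v3\<close>, as in the next case, exchanges the
      roles of \<open>W 0\<close> and \<open>v4\<close>.\<close>
    assume "(v2, v3, ws, ws') = (W (-2), W 1, [W (-1), x], [W 2, y])"
    then show ?thesis
      by (intro rim'[of "W 0" v4 "-1"]) (simp_all, rule order_trans[OF E'], auto simp: split_edges_def)
  next
    assume "(v2, v3, ws, ws') = (W 1, W (-2), [W 2, y], [W (-1), x])"
    then show ?thesis
      by (intro rim'[of v4 "W 0" "-1"]) (simp_all add: insert_commute, rule order_trans[OF E'], auto simp: split_edges_def)
  next
    assume "(v2, v3, ws, ws') = (W (-2), W 2, [W (-1), x, W 1], [y])"
    then show ?thesis
      by (intro rim[of "W 0" v4 "-2"]) (simp_all, rule order_trans[OF E'], auto simp: split_edges_def)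
  next
    assume "(v2, v3, ws, ws') = (W 2, W (-2), [y], [W (-1), x, W 1])"
    then show ?thesis
      by (intro rim[of v4 "W 0" "-2"]) (simp_all add: insert_commute, rule order_trans[OF E'], auto simp: split_edges_def)
  next
    assume "(v2, v3, ws, ws') = (W (-1), W 2, [x, W 1], [y, W (-2)])"
    then show ?thesis
      by (intro rim[of "W 0" v4 "-1"]) (simp_all, rule order_trans[OF E'], auto simp: split_edges_def)
  next
    assume "(v2, v3, ws, ws') = (W 2, W (-1), [y, W (-2)], [x, W 1])"
    then show ?thesis
      by (intro rim[of v4 "W 0" "-1"]) (simp_all add: insert_commute, rule order_trans[OF E'], auto simp: split_edges_def)
  qed
qed

end

section \<open>Rotations of the even pseudo double wheel\<close>

text \<open>Adding \<open>length ws\<close> before subtracting 1 keeps the index of the predecessor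
  of entry 0 from being truncated.\<close>

lemma cyclic_pred_nth:
  assumes "distinct ws" "i < length ws"
  shows "cyclic_pred ws (ws ! i) = ws ! ((i + length ws - 1) mod length ws)"
proof -
  have t: "takeWhile (\<lambda>b. b \<noteq> ws ! i) ws = take i ws"
    by (rule takeWhile_eq_take_P_nth) (use assms in \<open>auto simp: nth_eq_iff_index_eq\<close>)
  then have d: "dropWhile (\<lambda>b. b \<noteq> ws ! i) ws = drop i ws"
    using assms(2) by (simp add: dropWhile_eq_drop)
  show ?thesis
  proof (cases i)
    case 0
    then show ?thesis using assms(2) unfolding cyclic_pred_def t d by (simp add: last_conv_nth)
  next
    case (Suc k)
    have "(Suc k + length ws - 1) mod length ws = k" using Suc assms(2) by simp
    moreover have "last (drop i ws @ take i ws) = ws ! k"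
      using Suc assms(2) by (cases "ws = []") (simp_all add: last_append last_conv_nth min_absorb2)
    ultimately show ?thesis unfolding cyclic_pred_def t d unfolding Suc by simp
  qed
qed

lemma cyclic_pred_three:
  assumes "distinct [a, b, c]"
  shows "cyclic_pred [a, b, c] a = c" "cyclic_pred [a, b, c] b = a" "cyclic_pred [a, b, c] c = b"
  using assms by (auto simp: cyclic_pred_def)

text \<open>The cycle in its own order: even positions are the \<open>v i\<close>, odd ones the
  \<open>u i\<close>, continued periodically.\<close>

definition rim :: "nat \<Rightarrow> (nat \<Rightarrow> 'a) \<Rightarrow> (nat \<Rightarrow> 'a) \<Rightarrow> int \<Rightarrow> 'a" where
  "rim n v u j = (if even j then v else u) (nat (j div 2 mod int n))"

lemma rim_interleave:
  "k \<le> n \<Longrightarrow> concat (map (\<lambda>i. [v i, u i]) [0..<k]) = map (\<lambda>i. rim n v u (int i)) [0..<2 * k]"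
  by (induction k) (simp_all add: rim_def)

context
  fixes n v u x y V S
  assumes quad: "pdw_quadrangulation n v u x y V S"
begin

private abbreviation "W \<equiv> rim n v u"

lemma pdw_size: "n \<ge> 3"
  and S_x: "S x = rev (map u [0..<n])" and S_y: "S y = map v [0..<n]"
  and S_v: "i < n \<Longrightarrow> S (v i) = [y, u ((i + n - 1) mod n), u i]"
  and S_u: "i < n \<Longrightarrow> S (u i) = [x, v ((i + 1) mod n), v i]"
  and V_quad: "V = {x, y} \<union> v ` {..<n} \<union> u ` {..<n}"
  and pdw_distinct: "distinct (x # y # map v [0..<n] @ map u [0..<n])"
  using quad unfolding pdw_quadrangulation_def by auto

lemma rim_even: "W (2 * j) = v (nat (j mod int n))" and rim_odd: "W (2 * j + 1) = u (nat (j mod int n))"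
  by (simp_all add: rim_def)

lemma uv_distinct:
  "i < n \<Longrightarrow> j < n \<Longrightarrow> v i = v j \<longleftrightarrow> i = j" "i < n \<Longrightarrow> j < n \<Longrightarrow> u i = u j \<longleftrightarrow> i = j"
  "i < n \<Longrightarrow> j < n \<Longrightarrow> v i \<noteq> u j" "i < n \<Longrightarrow> j < n \<Longrightarrow> u i \<noteq> v j"
  "i < n \<Longrightarrow> v i \<noteq> x" "i < n \<Longrightarrow> v i \<noteq> y" "i < n \<Longrightarrow> u i \<noteq> x" "i < n \<Longrightarrow> u i \<noteq> y"
  "i < n \<Longrightarrow> x \<noteq> v i" "i < n \<Longrightarrow> y \<noteq> v i" "i < n \<Longrightarrow> x \<noteq> u i" "i < n \<Longrightarrow> y \<noteq> u i" "x \<noteq> y"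
proof -
  have "inj_on v {..<n}" "inj_on u {..<n}" "v ` {..<n} \<inter> u ` {..<n} = {}" "x \<noteq> y"
    "x \<notin> v ` {..<n}" "x \<notin> u ` {..<n}" "y \<notin> v ` {..<n}" "y \<notin> u ` {..<n}"
    using pdw_distinct by (auto simp: distinct_map atLeast0LessThan)
  then show "i < n \<Longrightarrow> j < n \<Longrightarrow> v i = v j \<longleftrightarrow> i = j" "i < n \<Longrightarrow> j < n \<Longrightarrow> u i = u j \<longleftrightarrow> i = j"
    "i < n \<Longrightarrow> j < n \<Longrightarrow> v i \<noteq> u j" "i < n \<Longrightarrow> j < n \<Longrightarrow> u i \<noteq> v j"
    "i < n \<Longrightarrow> v i \<noteq> x" "i < n \<Longrightarrow> v i \<noteq> y" "i < n \<Longrightarrow> u i \<noteq> x" "i < n \<Longrightarrow> u i \<noteq> y"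
    "i < n \<Longrightarrow> x \<noteq> v i" "i < n \<Longrightarrow> y \<noteq> v i" "i < n \<Longrightarrow> x \<noteq> u i" "i < n \<Longrightarrow> y \<noteq> u i" "x \<noteq> y"
    by (blast dest: inj_onD)+
qed

lemma rim_eq_iff: "W i = W j \<longleftrightarrow> i mod int (2 * n) = j mod int (2 * n)"
proof -
  have less: "nat (k mod int n) < n" for k using pdw_size by (simp add: nat_less_iff)
  have eq: "nat (k mod int n) = nat (l mod int n) \<longleftrightarrow> k mod int n = l mod int n" for k l
    using pdw_size by (simp add: eq_nat_nat_iff)
  \<comment> \<open>A residue modulo \<open>2 * n\<close> amounts to a parity and a residue of the
    half modulo \<open>n\<close>, the two data from which \<open>rim\<close> is built.\<close>
  have mod: "k mod int (2 * n) = 2 * (k div 2 mod int n) + k mod 2" for k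
    using zmod_zmult2_eq[of "int n" k 2] by simp
  have "W i = W j \<longleftrightarrow> (even i \<longleftrightarrow> even j) \<and> i div 2 mod int n = j div 2 mod int n"
    by (auto simp: rim_def uv_distinct less eq)
  also have "\<dots> \<longleftrightarrow> i mod int (2 * n) = j mod int (2 * n)"
  proof -
    have "(even i \<longleftrightarrow> even j) \<and> a = b \<longleftrightarrow> 2 * a + i mod 2 = 2 * b + j mod 2" for a b :: int
      by presburger
    then show ?thesis unfolding mod .
  qed
  finally show ?thesis .
qed

lemma rim_range: "range W = v ` {..<n} \<union> u ` {..<n}"
proof (intro equalityI subsetI)
  fix w assume "w \<in> range W"
  then obtain j where "w = W j" by blast
  moreover have "nat (j div 2 mod int n) < n" using pdw_size by (simp add: nat_less_iff)
  ultimately show "w \<in> v ` {..<n} \<union> u ` {..<n}" unfolding rim_def by auto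
next
  fix w assume "w \<in> v ` {..<n} \<union> u ` {..<n}"
  then obtain i where "i < n" "w = W (2 * int i) \<or> w = W (2 * int i + 1)"
    unfolding rim_even rim_odd by auto
  then show "w \<in> range W" by blast
qed

lemma rim_nat: "i < n \<Longrightarrow> W (2 * int i) = v i" "i < n \<Longrightarrow> W (2 * int i + 1) = u i"
  "W (2 * int i) = v (i mod n)" "W (2 * int i + 1) = u (i mod n)"
  unfolding rim_even rim_odd by (simp_all flip: of_nat_mod)

lemma rim_neighbours:
  assumes "i < n"
  shows "v ((i + 1) mod n) = W (2 * int i + 2)" "u ((i + 1) mod n) = W (2 * int i + 3)"
    "v ((i + n - 1) mod n) = W (2 * int i - 2)" "u ((i + n - 1) mod n) = W (2 * int i - 1)"
proof -
  show "v ((i + 1) mod n) = W (2 * int i + 2)" "u ((i + 1) mod n) = W (2 * int i + 3)"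
    using rim_nat(3,4)[of "i + 1"] by (simp_all add: algebra_simps)
  have "2 * int (i + n - 1) = 2 * int i - 2 + int (2 * n)" using pdw_size by simp
  then have "W (2 * int (i + n - 1)) = W (2 * int i - 2)" "W (2 * int (i + n - 1) + 1) = W (2 * int i - 1)"
    by (simp_all add: rim_eq_iff algebra_simps mod_eq_dvd_iff)
  then show "v ((i + n - 1) mod n) = W (2 * int i - 2)" "u ((i + n - 1) mod n) = W (2 * int i - 1)"
    unfolding rim_nat(3,4) by simp_all
qed

private abbreviation "R \<equiv> add_face_diagonals S"

lemma mod_less_n: "k mod n < n"
  using pdw_size by simp

lemma cyclic_pred_v:
  assumes "i < n"
  shows "cyclic_pred (S (v i)) y = u i" "cyclic_pred (S (v i)) (u ((i + n - 1) mod n)) = y"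
    "cyclic_pred (S (v i)) (u i) = u ((i + n - 1) mod n)"
proof -
  have "(i + n - 1) mod n \<noteq> i"
  proof
    assume "(i + n - 1) mod n = i"
    moreover have "(i + n - 1) mod n = (if i = 0 then n - 1 else i - 1)"
      using assms by (cases i) auto
    ultimately show False using pdw_size by (auto split: if_splits)
  qed
  then have "distinct [y, u ((i + n - 1) mod n), u i]"
    using assms mod_less_n by (simp add: uv_distinct)
  from cyclic_pred_three[OF this] show "cyclic_pred (S (v i)) y = u i"
    "cyclic_pred (S (v i)) (u ((i + n - 1) mod n)) = y"
    "cyclic_pred (S (v i)) (u i) = u ((i + n - 1) mod n)" unfolding S_v[OF assms] by simp_all
qed

lemma cyclic_pred_u:
  assumes "i < n"
  shows "cyclic_pred (S (u i)) x = v i" "cyclic_pred (S (u i)) (v ((i + 1) mod n)) = x"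
    "cyclic_pred (S (u i)) (v i) = v ((i + 1) mod n)"
proof -
  have "(i + 1) mod n \<noteq> i" using assms pdw_size by (auto simp: mod_if)
  then have "distinct [x, v ((i + 1) mod n), v i]"
    using assms mod_less_n by (simp add: uv_distinct)
  from cyclic_pred_three[OF this] show "cyclic_pred (S (u i)) x = v i"
    "cyclic_pred (S (u i)) (v ((i + 1) mod n)) = x"
    "cyclic_pred (S (u i)) (v i) = v ((i + 1) mod n)" unfolding S_u[OF assms] by simp_all
qed

lemma cyclic_pred_hubs:
  assumes "i < n"
  shows "cyclic_pred (S x) (u i) = u ((i + 1) mod n)" "cyclic_pred (S y) (v i) = v ((i + n - 1) mod n)"
proof -
  have "distinct (map v [0..<n])" "distinct (map u [0..<n])" using pdw_distinct by simp_all
  from cyclic_pred_nth[OF this(1), of i] show "cyclic_pred (S y) (v i) = v ((i + n - 1) mod n)"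
    using assms mod_less_n by (simp add: S_y)
  let ?us = "rev (map u [0..<n])"
  have us: "?us ! j = u (n - 1 - j)" if "j < n" for j using that by (simp add: rev_nth)
  have "distinct ?us" using \<open>distinct (map u [0..<n])\<close> by simp
  from cyclic_pred_nth[OF this, of "n - 1 - i"]
  have "cyclic_pred ?us (u i) = u (n - 1 - (n - 1 - i + n - 1) mod n)"
    using assms mod_less_n us[of "n - 1 - i"] us[OF mod_less_n, of "n - 1 - i + n - 1"] by simp
  moreover have "n - 1 - (n - 1 - i + n - 1) mod n = (i + 1) mod n"
  proof (cases "i = n - 1")
    case False
    then have "n - 1 - i + n - 1 = (n - 2 - i) + n" "n - 2 - i < n" "i + 1 < n" using assms by linarith+
    then have "(n - 1 - i + n - 1) mod n = n - 2 - i" by (metis mod_add_self2 mod_less)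
    then show ?thesis using \<open>i + 1 < n\<close> by simp
  qed (use assms in simp)
  ultimately show "cyclic_pred (S x) (u i) = u ((i + 1) mod n)" unfolding S_x by simp
qed

text \<open>Quadrangulation edges and diagonals alternate: \<open>y\<close> and the rim neighbours
  at distance one are old, while \<open>x\<close> and those at distance two are opposite corners of
  faces.\<close>

lemma rotation_v:
  assumes "i < n"
  shows "R (v i) = [y, W (2 * int i - 2), W (2 * int i - 1), x, W (2 * int i + 1), W (2 * int i + 2)]"
proof -
  let ?j = "(i + n - 1) mod n"
  have "(?j + 1) mod n = i" using assms pdw_size by (simp add: mod_simps)
  then have "cyclic_pred (S (u ?j)) (v i) = x" using cyclic_pred_u(2)[OF mod_less_n, of "i + n - 1"] by simp
  then show ?thesis
    unfolding add_face_diagonals_def S_v[OF assms]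
    using cyclic_pred_hubs(2)[OF assms] cyclic_pred_u(3)[OF assms] rim_neighbours[OF assms]
      rim_nat(2)[OF assms] by simp
qed

lemma rotation_u:
  assumes "i < n"
  shows "R (u i) = [x, W (2 * int i + 3), W (2 * int i + 2), y, W (2 * int i), W (2 * int i - 1)]"
proof -
  let ?j = "(i + 1) mod n"
  have "(?j + n - 1) mod n = i"
  proof (cases "i + 1 = n")
    case False
    then have "i + 1 < n" using assms by simp
    then show ?thesis by simp
  qed (use assms in auto)
  then have "cyclic_pred (S (v ?j)) (u i) = y" using cyclic_pred_v(2)[OF mod_less_n, of "i + 1"] by simp
  then show ?thesis
    unfolding add_face_diagonals_def S_u[OF assms]
    using cyclic_pred_hubs(1)[OF assms] cyclic_pred_v(3)[OF assms] rim_neighbours[OF assms]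
      rim_nat(1)[OF assms] by simp
qed

lemma rotation_y: "R y = map (\<lambda>i. W (int i)) [0..<2 * n]"
proof -
  have "R y = concat (map (\<lambda>i. [v i, u i]) [0..<n])"
    unfolding add_face_diagonals_def S_y map_map
    by (intro arg_cong[of _ _ concat] map_cong refl) (simp add: cyclic_pred_v)
  then show ?thesis by (simp add: rim_interleave)
qed

text \<open>From outside, the rim appears in reverse; the first entry \<open>u (n - 1)\<close> has
  the index -1.\<close>

lemma rotation_x: "R x = map (\<lambda>i. W (- 1 - int i)) [0..<2 * n]"
proof -
  have "R x = concat (map (\<lambda>i. [u i, v i]) (rev [0..<n]))"
    unfolding add_face_diagonals_def S_x rev_map map_map
    by (intro arg_cong[of _ _ concat] map_cong refl) (simp add: cyclic_pred_u)
  also have "\<dots> = rev (concat (map (\<lambda>i. [v i, u i]) [0..<n]))"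
    by (simp add: rev_concat rev_map comp_def)
  also have "\<dots> = rev (map (\<lambda>i. W (int i)) [0..<2 * n])" by (simp add: rim_interleave)
  also have "\<dots> = map (\<lambda>i. W (- 1 - int i)) [0..<2 * n]"
  proof (rule nth_equalityI)
    fix i assume "i < length (rev (map (\<lambda>i. W (int i)) [0..<2 * n]))"
    then have i: "i < 2 * n" by simp
    then have "int (2 * n - 1 - i) = - 1 - int i + int (2 * n)" by linarith
    then have "W (int (2 * n - 1 - i)) = W (- 1 - int i)" unfolding rim_eq_iff by simp
    then show "rev (map (\<lambda>i. W (int i)) [0..<2 * n]) ! i = map (\<lambda>i. W (- 1 - int i)) [0..<2 * n] ! i"
      using i by (simp add: rev_nth)
  qed simp
  finally show ?thesis .
qed

lemma rotation_rim:
  "R (W c) = [y, W (c - 2), W (c - 1), x, W (c + 1), W (c + 2)] \<or>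
   R (W c) = [x, W (c + 2), W (c + 1), y, W (c - 1), W (c - 2)]"
proof -
  have step: ?thesis
    if d: "W c = W d" "R (W d) = [y, W (d - 2), W (d - 1), x, W (d + 1), W (d + 2)] \<or>
      R (W d) = [x, W (d + 2), W (d + 1), y, W (d - 1), W (d - 2)]" for d
  proof -
    have "W (c + k) = W (d + k)" "W (c - k) = W (d - k)" for k
      using d(1) unfolding rim_eq_iff by (rule mod_add_cong[OF _ refl], rule mod_diff_cong[OF _ refl])
    then show ?thesis using d by simp
  qed
  have "W c \<in> v ` {..<n} \<union> u ` {..<n}" unfolding rim_range[symmetric] by simp
  then consider i where "i < n" "W c = v i" | i where "i < n" "W c = u i" by auto
  then show ?thesis
  proof cases
    case (1 i)
    then show ?thesis by (intro step[of "2 * int i"]) (simp_all add: rotation_v rim_nat(1))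
  next
    case (2 i)
    then show ?thesis by (intro step[of "2 * int i + 1"]) (simp_all add: rotation_u rim_nat(2) add.assoc)
  qed
qed

lemma rim_mod: "W (j mod int (2 * n)) = W j"
  by (simp add: rim_eq_iff)

lemma set_rotation_hubs: "set (R x) = range W" "set (R y) = range W"
proof -
  have all: "W j \<in> (\<lambda>i. W (int i)) ` {0..<2 * n}" for j
  proof (rule image_eqI)
    have "0 \<le> j mod int (2 * n)" "j mod int (2 * n) < int (2 * n)" using pdw_size by simp_all
    then show "nat (j mod int (2 * n)) \<in> {0..<2 * n}" "W j = W (int (nat (j mod int (2 * n))))"
      using rim_mod[of j] by (simp_all add: nat_less_iff)
  qed
  then show "set (R y) = range W" unfolding rotation_y by auto
  have "W j \<in> (\<lambda>i. W (- 1 - int i)) ` {0..<2 * n}" for j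
  proof (rule image_eqI)
    let ?k = "(- 1 - j) mod int (2 * n)"
    have k: "0 \<le> ?k" "?k < int (2 * n)" using pdw_size by simp_all
    then show "nat ?k \<in> {0..<2 * n}" by (simp add: nat_less_iff)
    have "(- 1 - ?k) mod int (2 * n) = (- 1 - (- 1 - j)) mod int (2 * n)" by (rule mod_diff_right_eq)
    then have "W (- 1 - ?k) = W j" unfolding rim_eq_iff by simp
    then show "W j = W (- 1 - int (nat ?k))" using k by simp
  qed
  then show "set (R x) = range W" unfolding rotation_x by auto
qed

lemma set_rotation_rim: "set (R (W c)) = {x, y, W (c - 2), W (c - 1), W (c + 1), W (c + 2)}"
  using rotation_rim[of c] by auto

lemma pdw_double_wheel: "double_wheel (2 * n) W x y V (rotation_edges V R)"
proof -
  have V: "V = {x, y} \<union> range W" unfolding V_quad rim_range by blast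
  have xy: "x \<noteq> y" "x \<notin> range W" "y \<notin> range W" unfolding rim_range by (auto simp: uv_distinct)
  have "rotation_edges V R = {{x, W i} | i. True} \<union> {{y, W i} | i. True}
       \<union> {{W i, W (i + 1)} | i. True} \<union> {{W i, W (i + 2)} | i. True}" (is "_ = ?E")
  proof (intro equalityI subsetI)
    fix e assume "e \<in> rotation_edges V R"
    then obtain p w where e: "e = {p, w}" "p \<in> V" "w \<in> set (R p)" unfolding rotation_edges_def by blast
    then consider "p = x" | "p = y" | c where "p = W c" unfolding V by blast
    then show "e \<in> ?E"
    proof cases
      case 1
      then show ?thesis using e set_rotation_hubs by auto
    next
      case 2
      then show ?thesis using e set_rotation_hubs by auto
    next
      case (3 c)
      then have "w \<in> {x, y, W (c - 2), W (c - 1), W (c + 1), W (c + 2)}"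
        using e(3) set_rotation_rim by simp
      then have "e = {x, W c} \<or> e = {y, W c} \<or> e = {W (c - 2), W (c - 2 + 2)} \<or>
          e = {W (c - 1), W (c - 1 + 1)} \<or> e = {W c, W (c + 1)} \<or> e = {W c, W (c + 2)}"
        unfolding e(1) 3 by auto
      then show ?thesis by blast
    qed
  next
    have "x \<in> V" "y \<in> V" "W i \<in> V" for i unfolding V by blast+
    have mem: "{p, w} \<in> rotation_edges V R" if "p \<in> V" "w \<in> set (R p)" for p w
      using that unfolding rotation_edges_def by blast
    fix e assume "e \<in> ?E"
    then consider i where "e = {x, W i}" | i where "e = {y, W i}"
      | i where "e = {W i, W (i + 1)}" | i where "e = {W i, W (i + 2)}" by blast
    then show "e \<in> rotation_edges V R"
      using \<open>x \<in> V\<close> \<open>y \<in> V\<close> \<open>\<And>i. W i \<in> V\<close>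
      by cases (auto intro!: mem simp: set_rotation_hubs set_rotation_rim)
  qed
  then show ?thesis
    unfolding double_wheel_def using pdw_size rim_eq_iff V xy by simp
qed

text \<open>Reindexing the rim, reversing its direction and exchanging the hubs reduces every vertex to
  one of two normal forms.\<close>

lemma rotation_normal_form:
  assumes "p \<in> V"
  obtains m F x' y' where "double_wheel m F x' y' V (rotation_edges V R)"
    "(p = F 0 \<and> R p = [y', F (-2), F (-1), x', F 1, F 2]) \<or>
     (p = x' \<and> R p = map (\<lambda>i. F (int i)) [0..<m])"
proof -
  note dw = pdw_double_wheel
  have "p = x \<or> p = y \<or> p \<in> range W" using assms unfolding V_quad rim_range by blast
  then consider "p = x" | "p = y" | c where "p = W c" by blast
  then show thesis
  proof cases
    case 1
    \<comment> \<open>The composite indexing sends \<open>i\<close> to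
      \<open>W (- 1 - i)\<close>.\<close>
    show thesis
      by (rule that[OF double_wheel_shift[OF double_wheel_reflect[OF dw], of 1]])
        (simp add: 1 rotation_x)
  next
    case 2
    show thesis
      by (rule that[OF double_wheel_swap[OF dw]]) (simp add: 2 rotation_y)
  next
    case (3 c)
    from rotation_rim[of c] show thesis
    proof
      assume "R (W c) = [y, W (c - 2), W (c - 1), x, W (c + 1), W (c + 2)]"
      then show thesis
        by (intro that[OF double_wheel_shift[OF dw, of c]]) (simp add: 3)
    next
      assume "R (W c) = [x, W (c + 2), W (c + 1), y, W (c - 1), W (c - 2)]"
      \<comment> \<open>The composite indexing sends \<open>i\<close> to \<open>W (c - i)\<close>;
        the swap makes \<open>x\<close> the hub at the head of the list.\<close>
      then show thesis
        by (intro that[OF double_wheel_swap[OF double_wheel_shift[OF double_wheel_reflect[OF dw], of "- c"]]])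
          (simp add: 3 add.commute)
    qed
  qed
qed

end

section \<open>Splitting an arbitrary vertex\<close>

lemma rim_edge_neighbours:
  assumes dw: "double_wheel m W x y V E" and e: "e \<in> E" "W 0 \<in> e"
  shows "\<exists>w\<in>{y, W (-2), W (-1), x, W 1, W 2}. e = {W 0, w}"
proof -
  have cong: "W (i + d) = W (j + d)" "W (i - d) = W (j - d)" if "W i = W j" for i j d
    using that unfolding W_eq_iff[OF dw] by (rule mod_add_cong[OF _ refl], rule mod_diff_cong[OF _ refl])
  have "(\<exists>i. e = {x, W i}) \<or> (\<exists>i. e = {y, W i}) \<or>
      (\<exists>i. e = {W i, W (i + 1)}) \<or> (\<exists>i. e = {W i, W (i + 2)})"
    using e(1) dw unfolding double_wheel_def by simp
  then consider "x \<in> e" | "y \<in> e" | i where "e = {W i, W (i + 1)}" | i where "e = {W i, W (i + 2)}"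
    by (elim disjE exE) simp_all
  then show ?thesis
  proof cases
    case 1
    then obtain i where "e = {x, W i}" using edge_at_x[OF dw e(1)] by blast
    moreover from this have "W i = W 0" using e(2) hubs_distinct[OF dw] by fastforce
    ultimately show ?thesis by (simp add: insert_commute)
  next
    case 2
    then obtain i where "e = {y, W i}" using edge_at_y[OF dw e(1)] by blast
    moreover from this have "W i = W 0" using e(2) hubs_distinct[OF dw] by fastforce
    ultimately show ?thesis by (simp add: insert_commute)
  next
    case (3 i)
    then consider "W i = W 0" | "W (i + 1) = W 0" using e(2) by auto
    then show ?thesis
    proof cases
      case 1
      then show ?thesis using cong(1)[of i 0 1] 3 by auto
    next
      case 2
      then show ?thesis using cong(2)[of "i + 1" 0 1] 3 by auto
    qed
  next
    case (4 i)
    then consider "W i = W 0" | "W (i + 2) = W 0" using e(2) by auto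
    then show ?thesis
    proof cases
      case 1
      then show ?thesis using cong(1)[of i 0 2] 4 by auto
    next
      case 2
      then show ?thesis using cong(2)[of "i + 2" 0 2] 4 by auto
    qed
  qed
qed

lemma hub_edge_neighbours:
  assumes dw: "double_wheel m W x y V E" and e: "e \<in> E" "x \<in> e"
  shows "\<exists>w\<in>set (map (\<lambda>i. W (int i)) [0..<m]). e = {x, w}"
proof -
  obtain i where i: "e = {x, W i}" using edge_at_x[OF dw e] by blast
  obtain j where "0 \<le> j" "j < 0 + int m" "W i = W j" by (rule rim_representative[OF dw])
  then have "nat j \<in> {0..<m}" "e = {x, W (int (nat j))}" using i by auto
  then show ?thesis unfolding set_map set_upt by blast
qed

lemma Qv_splitting_visible:
  assumes even: "even_pdw_drawing V R" and split: "Qv_splitting V R v1 v2 v3 v4 V' E'"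
    and sg: "simple_graph V' E'"
  shows "bar_1_visible V' E'"
proof -
  obtain n v u x y S where quad: "pdw_quadrangulation n v u x y V S" and R: "R = add_face_diagonals S"
    using even unfolding even_pdw_drawing_def by blast
  let ?E = "rotation_edges V R"
  obtain k ws ws' where rot: "rotate k (R v1) = v2 # ws @ v3 # ws'" and V': "V' = insert v4 V"
    and E': "E' = (?E - {{v1, w} | w. w \<in> set ws'}) \<union> {{v4, w} | w. w \<in> set ws'}
             \<union> {{v4, v2}, {v4, v3}} \<union> {{v1, v4}, {v2, v3}}"
    and split': "v1 \<in> V" "v4 \<notin> V" "{v2, v3} \<notin> ?E"
    using split unfolding Qv_splitting_def by blast
  obtain m W x' y' where dw: "double_wheel m W x' y' V ?E"
    and cases: "(v1 = W 0 \<and> R v1 = [y', W (-2), W (-1), x', W 1, W 2]) \<or>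
     (v1 = x' \<and> R v1 = map (\<lambda>i. W (int i)) [0..<m])"
    using rotation_normal_form[OF quad split'(1)] unfolding R .
  have neighbours: "\<exists>w\<in>set (R v1). e = {v1, w}" if "e \<in> ?E" "v1 \<in> e" for e
    using cases rim_edge_neighbours[OF dw that(1)] hub_edge_neighbours[OF dw that(1)] that(2) by auto
  have set_R: "set (R v1) = {v2, v3} \<union> set ws \<union> set ws'"
    using arg_cong[OF rot, of set] by auto
  have "e \<in> split_edges ?E v1 v4 v2 v3 (set ws) (set ws')" if e: "e \<in> E'" for e
  \<comment> \<open>The delicate edges are the old ones remaining at \<open>v1\<close>: each goes to
    an entry of the rotation at \<open>v1\<close>, hence to \<open>ws\<close> or to a
    separator.\<close>
  proof (cases "e \<in> ?E \<and> v1 \<in> e \<and> e \<notin> {{v1, w} | w. w \<in> set ws'}")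
    case True
    then obtain w where "w \<in> set ws \<union> {v2, v3}" "e = {v1, w}"
      using neighbours[of e] unfolding set_R by blast
    then show ?thesis unfolding split_edges_def by blast
  next
    case False
    then show ?thesis using e unfolding E' split_edges_def by blast
  qed
  then have E'_sub: "E' \<subseteq> split_edges ?E v1 v4 v2 v3 (set ws) (set ws')" by blast
  from cases show ?thesis
  proof
    assume a: "v1 = W 0 \<and> R v1 = [y', W (-2), W (-1), x', W 1, W 2]"
    show ?thesis
      by (rule rim_splitting[OF dw sg split'(2) V' rot[unfolded conjunct2[OF a]]
            E'_sub[unfolded conjunct1[OF a]] split'(3)])
  next
    assume a: "v1 = x' \<and> R v1 = map (\<lambda>i. W (int i)) [0..<m]"
    show ?thesis
      by (rule hub_splitting[OF dw sg split'(2) V' rot[unfolded conjunct2[OF a]]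
            E'_sub[unfolded conjunct1[OF a]]])
  qed
qed

theorem theorem6:
  fixes V :: "'a set" and E :: "'a set set"
  assumes "pdw_graph V E"
  shows "bar_1_visible V E"
  using assms unfolding pdw_graph_def
proof
  assume "even_pdw_graph V E"
  then obtain n v u x y S where quad: "pdw_quadrangulation n v u x y V S"
    and E: "E = rotation_edges V (add_face_diagonals S)"
    unfolding even_pdw_graph_def even_pdw_drawing_def by blast
  show ?thesis unfolding E by (rule double_wheel_visible[OF pdw_double_wheel[OF quad]])
next
  assume "odd_pdw_graph V E"
  \<comment> \<open>Simplicity of the split graph comes from its 1-planarity.\<close>
  then show ?thesis
    unfolding odd_pdw_graph_def optimal_one_planar_def one_planar_def
    by (elim conjE exE) (erule (2) Qv_splitting_visible)
qed

end
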